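(* There exist absolute constants $c>0$ and $k_0$ such that for every $k\ge k_0$ and every bivariate polynomial $f(x,y)\in\mathbb{C}[x,y]$ whose Newton polytope $\mathrm{Newt}(f)$ has exactly $k$ vertices, there exists $a\in\mathbb{C}\setminus\{0\}$ such that the univariate polynomial $f(x,a)$ satisfies $B(f(x,a))\ge c\sqrt k$.
   Context: For $f(x,y)=\sum_{i,j}a_{i,j}x^iy^j$, $\mathrm{supp}(f):=\{(i,j):a_{i,j}\ne0\}$ and $\mathrm{Newt}(f)\subseteq\mathbb{R}^2$ is the convex hull of $\mathrm{supp}(f)$. For a univariate complex polynomial $g$ with non-zero roots $r_1e^{\imath\phi_1},\dots,r_ne^{\imath\phi_n}$ (listed with multiplicity, $r_i>0$, $\phi_i\in[0,2\pi)$), the bias is $$B(g):=\sup_{0\le\alpha\le\beta\le2\pi}\Big|N_{\alpha,\beta}(g)-\frac{n(\beta-\alpha)}{2\pi}\Big|,$$ where $N_{\alpha,\beta}(g)$ is the number of these roots (with multiplicity) with $\phi_i\in[\alpha,\beta]$. *)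

theory Defs
  imports "HOL-Analysis.Analysis" "HOL-Computational_Algebra.Polynomial"
begin

text \<open>A bivariate polynomial f(x,y) = sum a_{i,j} x^i y^j in C[x,y] is represented by
  its coefficient function F :: nat * nat => complex, required to have finite support.\<close>

definition supp2 :: "(nat \<times> nat \<Rightarrow> complex) \<Rightarrow> (nat \<times> nat) set" where
  "supp2 F = {p. F p \<noteq> 0}"

definition is_bipoly :: "(nat \<times> nat \<Rightarrow> complex) \<Rightarrow> bool" where
  "is_bipoly F \<longleftrightarrow> finite (supp2 F)"

definition newt :: "(nat \<times> nat \<Rightarrow> complex) \<Rightarrow> (real \<times> real) set" where
  "newt F = convex hull ((\<lambda>(i, j). (real i, real j)) ` supp2 F)"

definition num_vertices :: "(real \<times> real) set \<Rightarrow> nat" where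
  "num_vertices P = card {v. v extreme_point_of P}"

definition spec_y :: "(nat \<times> nat \<Rightarrow> complex) \<Rightarrow> complex \<Rightarrow> complex poly" where
  "spec_y F a = (\<Sum>p\<in>supp2 F. monom (F p * a ^ snd p) (fst p))"

definition arg02pi :: "complex \<Rightarrow> real" where
  "arg02pi z = (if Arg z < 0 then Arg z + 2 * pi else Arg z)"

definition nonzero_roots :: "complex poly \<Rightarrow> complex set" where
  "nonzero_roots g = {z. z \<noteq> 0 \<and> poly g z = 0}"

definition nz_root_count :: "complex poly \<Rightarrow> nat" where
  "nz_root_count g = (\<Sum>z\<in>nonzero_roots g. order z g)"

definition N_arg :: "real \<Rightarrow> real \<Rightarrow> complex poly \<Rightarrow> nat" where
  "N_arg \<alpha> \<beta> g = (\<Sum>z\<in>{z\<in>nonzero_roots g. \<alpha> \<le> arg02pi z \<and> arg02pi z \<le> \<beta>}. order z g)"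

definition bias :: "complex poly \<Rightarrow> real" where
  "bias g = (SUP ab\<in>{(\<alpha>, \<beta>). 0 \<le> \<alpha> \<and> \<alpha> \<le> \<beta> \<and> \<beta> \<le> 2 * pi}.
     \<bar>real (N_arg (fst ab) (snd ab) g) - real (nz_root_count g) * (snd ab - fst ab) / (2 * pi)\<bar>)"

end

theory Submission
  imports Defs "HOL-Complex_Analysis.Complex_Analysis"
    "HOL-Computational_Algebra.Fundamental_Theorem_Algebra" "HOL-Number_Theory.Cong"
begin

text \<open>
  One of the lower and the upper boundary of the Newton polygon has about \<open>k / 2\<close> edges; by symmetry take
  the lower one. As \<open>a \<rightarrow> 0\<close> the nonzero roots of \<open>f(x, a)\<close> split into groups, one per edge: the group of
  an edge of slope \<open>- e\<close> consists of approximately \<open>a\<^sup>e t\<close>, where \<open>t\<close> runs over the nonzero roots of the edge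
  polynomial. Turning \<open>a\<close> rotates different groups with different speeds. The discrepancy of a group is
  the difference of the values of a sum of sawtooth functions at the ends of the interval. On average over
  the argument of \<open>a\<close>, the centred sums of different groups are orthogonal, so their variances add up. A
  group has integral masses, so its sum takes all values modulo 1 equally often and has variance bounded
  below. Hence some \<open>a\<close> has squared bias of order at least \<open>k\<close>. The averages are taken over a grid of
  \<open>M\<close>-th roots of unity with \<open>M\<close> a large prime.
\<close>

section \<open>Shifts of periodic functions on the integers\<close>

lemma periodic_mod:
  fixes g :: "int \<Rightarrow> 'a"
  assumes "periodic_fun_simple g M"
  shows "g (j mod M) = g j"
proof -
  interpret periodic_fun_simple g M by fact
  show ?thesis using minus_of_int[of j "j div M"] by (simp add: minus_div_mult_eq_mod)
qed

lemma sum_periodic_affine: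
  fixes g :: "int \<Rightarrow> 'a :: comm_monoid_add"
  assumes "periodic_fun_simple g M" "coprime e M" "M > 0"
  shows "(\<Sum>t\<in>{0..<M}. g (j + e * t)) = (\<Sum>t\<in>{0..<M}. g t)"
proof -
  have "inj_on (\<lambda>t. (j + e * t) mod M) {0..<M}"
  proof (rule inj_onI)
    fix x y assume xy: "x \<in> {0..<M}" "y \<in> {0..<M}" and "(j + e * x) mod M = (j + e * y) mod M"
    then have "[j + e * x = j + e * y] (mod M)" by (simp add: cong_def)
    then have "[x = y] (mod M)" using assms(2) by (simp add: cong_add_lcancel cong_mult_lcancel)
    then show "x = y" using xy by (simp add: cong_def)
  qed
  moreover have "(\<lambda>t. (j + e * t) mod M) ` {0..<M} \<subseteq> {0..<M}" using assms(3) by auto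
  ultimately have bij: "bij_betw (\<lambda>t. (j + e * t) mod M) {0..<M} {0..<M}"
    by (simp add: bij_betw_def endo_inj_surj)
  have "(\<Sum>t\<in>{0..<M}. g (j + e * t)) = (\<Sum>t\<in>{0..<M}. g ((j + e * t) mod M))"
    by (simp add: periodic_mod[OF assms(1)])
  also have "\<dots> = (\<Sum>t\<in>{0..<M}. g t)" by (rule sum.reindex_bij_betw[OF bij])
  finally show ?thesis .
qed

lemma sum_periodic_shift:
  fixes g :: "int \<Rightarrow> 'a :: comm_monoid_add"
  assumes "periodic_fun_simple g M" "M > 0"
  shows "(\<Sum>j\<in>{0..<M}. g (j + h)) = (\<Sum>j\<in>{0..<M}. g j)"
  using sum_periodic_affine[of g M 1 h] assms by (simp add: add.commute)

lemma sum_square_deviation_ge: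
  fixes D :: "int \<Rightarrow> real"
  assumes "periodic_fun_simple D M" "M > 0" and "\<delta> \<ge> 0" and jump: "\<And>j. \<delta> \<le> \<bar>D (j + h) - D j\<bar>"
  shows "of_int M * \<delta>\<^sup>2 / 4 \<le> (\<Sum>j\<in>{0..<M}. (D j - x)\<^sup>2)"
proof -
  have "of_int M * \<delta>\<^sup>2 = (\<Sum>j\<in>{0..<M}. \<delta>\<^sup>2)" using assms(2) by simp
  also have "\<dots> \<le> (\<Sum>j\<in>{0..<M}. 2 * (D (j + h) - x)\<^sup>2 + 2 * (D j - x)\<^sup>2)"
  proof (rule sum_mono)
    fix j
    have "\<delta>\<^sup>2 \<le> (D (j + h) - D j)\<^sup>2" using assms(3) jump[of j] by (metis abs_le_square_iff abs_of_nonneg)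
    also have "\<dots> \<le> 2 * (D (j + h) - x)\<^sup>2 + 2 * (D j - x)\<^sup>2"
      using zero_le_power2[of "(D (j + h) - x) + (D j - x)"] by (simp add: power2_eq_square algebra_simps)
    finally show "\<delta>\<^sup>2 \<le> 2 * (D (j + h) - x)\<^sup>2 + 2 * (D j - x)\<^sup>2" .
  qed
  also have "\<dots> = 2 * (\<Sum>j\<in>{0..<M}. (D (j + h) - x)\<^sup>2) + 2 * (\<Sum>j\<in>{0..<M}. (D j - x)\<^sup>2)"
    by (simp add: sum.distrib sum_distrib_left)
  also have "(\<Sum>j\<in>{0..<M}. (D (j + h) - x)\<^sup>2) = (\<Sum>j\<in>{0..<M}. (D j - x)\<^sup>2)"
    using assms(1,2) by (intro sum_periodic_shift) (simp_all add: periodic_fun_simple_def)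
  finally show ?thesis by simp
qed

lemma shift_increment_in_Ints:
  fixes D :: "int \<Rightarrow> real"
  assumes "\<And>j. D (j + 1) - D j - y \<in> \<int>"
  shows "D (j + int h) - D j - real h * y \<in> \<int>"
proof (induction h)
  case (Suc h)
  from Ints_add[OF Suc assms[of "j + int h"]] show ?case by (simp add: algebra_simps)
qed simp

text \<open>If \<open>n * h \<equiv> (M - 1) / 2\<close> modulo \<open>M\<close>, then shifting by \<open>h\<close> changes \<open>D\<close> by almost one half modulo 1,
  so \<open>D\<close> cannot stay close to any constant.\<close>

lemma variance_ge:
  fixes D :: "int \<Rightarrow> real" and n :: nat
  assumes "periodic_fun_simple D M" and M: "M \<ge> 3" "odd M" and "coprime (int n) M"
    and incr: "\<And>j. D (j + 1) - D j - real n / of_int M \<in> \<int>"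
  shows "of_int M / 36 \<le> (\<Sum>j\<in>{0..<M}. (D j - x)\<^sup>2)"
proof -
  define l where "l = (M - 1) div 2"
  have l: "M = 2 * l + 1" using M by (simp add: l_def)
  obtain h0 where "[int n * h0 = 1] (mod M)" using cong_solve_coprime_int assms(4) by auto
  then have "[int n * h0 * l = l] (mod M)" using cong_mult[OF _ cong_refl[of l]] by force
  moreover define h where "h = nat ((h0 * l) mod M)"
  then have "[int h = h0 * l] (mod M)" using M by (simp add: cong_def)
  then have "[int n * int h = int n * h0 * l] (mod M)" by (simp add: cong_scalar_left mult.assoc)
  ultimately have "M dvd int n * int h - l" using cong_trans cong_iff_dvd_diff by blast
  then obtain k where "int n * int h - l = M * k" by (elim dvdE)
  then have k: "int n * int h = l + M * k" by simp
  have "1 / 3 \<le> \<bar>D (j + int h) - D j\<bar>" for j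
  proof -
    obtain m where "D (j + int h) - D j - real h * (real n / of_int M) = of_int m"
      using shift_increment_in_Ints[of D, OF incr] by (metis Ints_cases)
    moreover have "real h * (real n / of_int M) = of_int k + of_int l / of_int M"
      using M arg_cong[OF k, of real_of_int] by (simp add: field_simps)
    ultimately have "D (j + int h) - D j = of_int (k + m) + of_int l / of_int M" by simp
    moreover have "1 / 3 \<le> of_int l / real_of_int M" "of_int l / real_of_int M \<le> 1 / 2"
      using M by (simp_all add: l field_simps)
    moreover have "k + m \<ge> 0 \<or> k + m \<le> - 1" by linarith
    then have "real_of_int (k + m) \<ge> 0 \<or> real_of_int (k + m) \<le> - 1" by linarith
    ultimately show ?thesis by linarith
  qed
  from sum_square_deviation_ge[OF assms(1) _ _ this, of x] M show ?thesis
    by (simp add: power2_eq_square)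
qed

lemma sum_product_shifts_eq_0:
  fixes f g :: "int \<Rightarrow> 'a :: comm_semiring_0"
  assumes f: "periodic_fun_simple f M" and g: "periodic_fun_simple g M" "(\<Sum>j\<in>{0..<M}. g j) = 0"
    and "M > 0" "coprime (e - d) M"
  shows "(\<Sum>t\<in>{0..<M}. \<Sum>j\<in>{0..<M}. f (j + d * t) * g (j + e * t)) = 0"
proof -
  have "(\<Sum>j\<in>{0..<M}. f (j + d * t) * g (j + e * t)) = (\<Sum>j\<in>{0..<M}. f j * g (j + (e - d) * t))" for t
  proof -
    have "periodic_fun_simple (\<lambda>j. f j * g (j + (e - d) * t)) M"
      using f g(1) unfolding periodic_fun_simple_def by (metis add.assoc add.commute)
    from sum_periodic_shift[OF this assms(4), of "d * t"] show ?thesis by (simp add: algebra_simps)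
  qed
  then have "(\<Sum>t\<in>{0..<M}. \<Sum>j\<in>{0..<M}. f (j + d * t) * g (j + e * t)) =
      (\<Sum>j\<in>{0..<M}. \<Sum>t\<in>{0..<M}. f j * g (j + (e - d) * t))"
    by (simp only:) (rule sum.swap)
  also have "\<dots> = (\<Sum>j\<in>{0..<M}. f j * (\<Sum>t\<in>{0..<M}. g (j + (e - d) * t)))" by (simp add: sum_distrib_left)
  also have "\<dots> = 0" by (simp add: sum_periodic_affine[OF g(1) assms(5,4)] g(2))
  finally show ?thesis .
qed

lemma sum_square_shifts:
  fixes g :: "'i \<Rightarrow> int \<Rightarrow> real"
  assumes "finite I" "M > 0"
    and per: "\<And>i. i \<in> I \<Longrightarrow> periodic_fun_simple (g i) M"
    and mean: "\<And>i. i \<in> I \<Longrightarrow> (\<Sum>j\<in>{0..<M}. g i j) = 0"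
    and cop: "\<And>i i'. i \<in> I \<Longrightarrow> i' \<in> I \<Longrightarrow> i \<noteq> i' \<Longrightarrow> coprime (d i' - d i) M"
  shows "(\<Sum>t\<in>{0..<M}. \<Sum>j\<in>{0..<M}. (\<Sum>i\<in>I. g i (j + d i * t))\<^sup>2) =
    of_int M * (\<Sum>i\<in>I. \<Sum>j\<in>{0..<M}. (g i j)\<^sup>2)"
proof -
  define G where "G i i' = (\<Sum>t\<in>{0..<M}. \<Sum>j\<in>{0..<M}. g i (j + d i * t) * g i' (j + d i' * t))" for i i'
  have diag: "G i i = of_int M * (\<Sum>j\<in>{0..<M}. (g i j)\<^sup>2)" if "i \<in> I" for i
  proof -
    have "periodic_fun_simple (\<lambda>j. (g i j)\<^sup>2) M" using per[OF that] by (simp add: periodic_fun_simple_def)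
    then have "(\<Sum>j\<in>{0..<M}. (g i (j + d i * t))\<^sup>2) = (\<Sum>j\<in>{0..<M}. (g i j)\<^sup>2)" for t
      using assms(2) by (rule sum_periodic_shift)
    then show ?thesis using assms(2) by (simp add: G_def flip: power2_eq_square)
  qed
  have off_diag: "G i i' = 0" if "i \<in> I" "i' \<in> I" "i \<noteq> i'" for i i'
    unfolding G_def using that per mean assms(2) cop by (intro sum_product_shifts_eq_0) auto
  have "(\<Sum>t\<in>{0..<M}. \<Sum>j\<in>{0..<M}. (\<Sum>i\<in>I. g i (j + d i * t))\<^sup>2) = (\<Sum>i\<in>I. \<Sum>i'\<in>I. G i i')"
    by (simp add: power2_eq_square sum_product G_def sum.swap[of _ I "{0..<M}"])
  also have "\<dots> = (\<Sum>i\<in>I. \<Sum>i'\<in>I. if i' = i then G i i else 0)"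
    using off_diag by (intro sum.cong) auto
  also have "\<dots> = of_int M * (\<Sum>i\<in>I. \<Sum>j\<in>{0..<M}. (g i j)\<^sup>2)"
    using assms(1) diag by (simp add: sum_distrib_left)
  finally show ?thesis .
qed

lemma sum_square_le_sum_square_diff:
  fixes X :: "'a \<Rightarrow> real"
  assumes "(\<Sum>j\<in>A. X j) = 0"
  shows "(\<Sum>j\<in>A. (X j)\<^sup>2) \<le> (\<Sum>j\<in>A. (X j - x)\<^sup>2)"
proof -
  have "(\<Sum>j\<in>A. (X j - x)\<^sup>2) = (\<Sum>j\<in>A. (X j)\<^sup>2) - 2 * x * (\<Sum>j\<in>A. X j) + of_nat (card A) * x\<^sup>2"
    by (simp add: power2_diff sum.distrib sum_subtractf sum_distrib_left sum_distrib_right mult_ac)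
  then show ?thesis using assms by simp
qed

lemma exists_large_sum_of_shifts:
  fixes D :: "'i \<Rightarrow> int \<Rightarrow> real"
  assumes "finite I" "M > 0"
    and per: "\<And>i. i \<in> I \<Longrightarrow> periodic_fun_simple (D i) M"
    and var: "\<And>i x. i \<in> I \<Longrightarrow> of_int M * v \<le> (\<Sum>j\<in>{0..<M}. (D i j - x)\<^sup>2)"
    and cop: "\<And>i i'. i \<in> I \<Longrightarrow> i' \<in> I \<Longrightarrow> i \<noteq> i' \<Longrightarrow> coprime (d i' - d i) M"
  shows "\<exists>t. \<exists>j\<in>{0..<M}. real (card I) * v \<le> (\<Sum>i\<in>I. D i (j + d i * t) - D i (d i * t))\<^sup>2"
proof (rule ccontr)
  define mean where "mean i = (\<Sum>j\<in>{0..<M}. D i j) / of_int M" for i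
  define g where "g i j = D i j - mean i" for i j
  define X where "X t j = (\<Sum>i\<in>I. g i (j + d i * t))" for t j
  assume "\<not> ?thesis"
  then have small: "(X t j - X t 0)\<^sup>2 < real (card I) * v" if "j \<in> {0..<M}" for t j
    using that by (auto simp: X_def g_def not_le simp flip: sum_subtractf)
  have g: "periodic_fun_simple (g i) M" if "i \<in> I" for i
    using per[OF that] by (simp add: g_def periodic_fun_simple_def)
  have mean_0: "(\<Sum>j\<in>{0..<M}. g i j) = 0" for i
    using assms(2) by (simp add: g_def mean_def sum_subtractf)
  have X_mean_0: "(\<Sum>j\<in>{0..<M}. X t j) = 0" for t
    using sum_periodic_shift[OF g assms(2)] mean_0 by (simp add: X_def sum.swap[of _ I])
  have "of_int M * (of_int M * (real (card I) * v)) = of_int M * (\<Sum>i\<in>I. of_int M * v)" by simp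
  also have "\<dots> \<le> of_int M * (\<Sum>i\<in>I. \<Sum>j\<in>{0..<M}. (g i j)\<^sup>2)"
    unfolding g_def using var assms(2) by (intro mult_left_mono sum_mono) auto
  also have "\<dots> = (\<Sum>t\<in>{0..<M}. \<Sum>j\<in>{0..<M}. (X t j)\<^sup>2)"
    unfolding X_def using assms(1,2) g mean_0 cop by (intro sum_square_shifts[symmetric]) auto
  also have "\<dots> \<le> (\<Sum>t\<in>{0..<M}. \<Sum>j\<in>{0..<M}. (X t j - X t 0)\<^sup>2)"
    by (intro sum_mono sum_square_le_sum_square_diff X_mean_0)
  also have "\<dots> < (\<Sum>t\<in>{0..<M}. \<Sum>j\<in>{0..<M}. real (card I) * v)"
    using small assms(2) by (intro sum_strict_mono) auto
  finally show False using assms(2) by simp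
qed

section \<open>Counting roots with multiplicity\<close>

definition root_count :: "'a::idom set \<Rightarrow> 'a poly \<Rightarrow> nat" where
  "root_count U p = (\<Sum>z\<in>{z\<in>U. poly p z = 0}. order z p)"

lemma root_count_mono:
  assumes "p \<noteq> 0" "U \<subseteq> V"
  shows "root_count U p \<le> root_count V p"
  unfolding root_count_def using poly_roots_finite[OF assms(1)] assms(2) by (intro sum_mono2) auto

lemma root_count_UN_disjoint:
  assumes "p \<noteq> 0" "finite I" "disjoint_family_on U I"
  shows "root_count (\<Union>i\<in>I. U i) p = (\<Sum>i\<in>I. root_count (U i) p)"
proof -
  have "{z\<in>\<Union>i\<in>I. U i. poly p z = 0} = (\<Union>i\<in>I. {z\<in>U i. poly p z = 0})" by auto
  then show ?thesis
    unfolding root_count_def using assms poly_roots_finite[OF assms(1)]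
    by (simp add: sum.UNION_disjoint disjoint_family_on_def disjoint_iff)
qed

lemma root_count_Un_disjoint:
  assumes "p \<noteq> 0" "U \<inter> V = {}"
  shows "root_count (U \<union> V) p = root_count U p + root_count V p"
proof -
  have "{z\<in>U \<union> V. poly p z = 0} = {z\<in>U. poly p z = 0} \<union> {z\<in>V. poly p z = 0}" by auto
  then show ?thesis
    unfolding root_count_def using assms poly_roots_finite[OF assms(1)]
    by (simp add: sum.union_disjoint disjoint_iff)
qed

lemma root_count_cong:
  assumes "\<And>z. poly p z = 0 \<Longrightarrow> z \<in> U \<longleftrightarrow> z \<in> V"
  shows "root_count U p = root_count V p"
  unfolding root_count_def using assms by (intro sum.cong) auto

lemma order_le_root_count:
  assumes "p \<noteq> 0" "t \<in> U"
  shows "order t p \<le> root_count U p"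
proof (cases "poly p t = 0")
  case True
  then show ?thesis
    unfolding root_count_def using assms poly_roots_finite[OF assms(1)]
    by (intro member_le_sum) auto
qed (simp add: order_0I)

lemma root_count_smult:
  assumes "c \<noteq> 0"
  shows "root_count U (smult c p) = root_count U p"
  using assms by (simp add: root_count_def order_smult)

lemma order_pcompose_scale:
  fixes p :: "'a :: field poly"
  assumes "p \<noteq> 0" "c \<noteq> 0"
  shows "order z (pcompose p [:0, c:]) = order (c * z) p"
proof -
  obtain q where q: "p = [:-(c * z), 1:] ^ order (c * z) p * q" "\<not> [:-(c * z), 1:] dvd q"
    using order_decomp[OF assms(1)] by blast
  have "pcompose [:-(c * z), 1:] [:0, c:] = smult c [:-z, 1:]" by (simp add: pcompose_pCons algebra_simps)
  moreover have "pcompose (r ^ n) [:0, c:] = pcompose r [:0, c:] ^ n" for r :: "'a poly" and n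
    by (induction n) (simp_all add: pcompose_mult pcompose_1)
  ultimately have decomp: "pcompose p [:0, c:] =
      smult (c ^ order (c * z) p) ([:-z, 1:] ^ order (c * z) p * pcompose q [:0, c:])"
    by (subst q(1)) (simp only: pcompose_mult smult_power mult_smult_left)
  have "poly (pcompose q [:0, c:]) z \<noteq> 0"
    using q(2) by (simp add: poly_pcompose poly_eq_0_iff_dvd mult.commute)
  then have "pcompose q [:0, c:] \<noteq> 0" "order z (pcompose q [:0, c:]) = 0" by (auto simp: order_0I)
  then show ?thesis using assms(2) unfolding decomp
    by (simp add: order_smult order_mult order_power_n_n)
qed

lemma root_count_pcompose_scale:
  fixes p :: "'a :: field poly"
  assumes "p \<noteq> 0" "c \<noteq> 0"
  shows "root_count U (pcompose p [:0, c:]) = root_count ((*) c ` U) p"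
proof -
  have "{x\<in>(*) c ` U. poly p x = 0} = (*) c ` {z\<in>U. poly (pcompose p [:0, c:]) z = 0}"
    by (auto simp: poly_pcompose mult.commute)
  moreover have "inj_on ((*) c) A" for A using assms(2) by (simp add: inj_on_def)
  ultimately show ?thesis
    unfolding root_count_def using assms by (simp add: sum.reindex order_pcompose_scale)
qed

lemma coeff_sum_monom_nonzero:
  assumes "coeff (\<Sum>p\<in>X. monom (c p) (d p)) i \<noteq> 0"
  shows "i \<in> d ` X"
proof (rule ccontr)
  assume "i \<notin> d ` X"
  then have "coeff (\<Sum>p\<in>X. monom (c p) (d p)) i = 0"
    unfolding coeff_sum by (intro sum.neutral) auto
  then show False using assms by simp
qed

lemma root_count_nonzero_add_order:
  fixes p :: "complex poly"
  assumes "p \<noteq> 0"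
  shows "root_count (- {0}) p + order 0 p = degree p"
proof -
  have "root_count {0} p = order 0 p"
    by (cases "poly p 0 = 0") (simp_all add: root_count_def order_0I cong: conj_cong)
  moreover have "root_count UNIV p = degree p"
    using size_proots_complex[of p] assms by (simp add: root_count_def size_multiset_overloaded_eq)
  moreover have "- {0} \<union> {0 :: complex} = UNIV" by auto
  ultimately show ?thesis using root_count_Un_disjoint[OF assms, of "- {0}" "{0}"] by simp
qed

lemma root_count_nonzero_le:
  fixes p :: "complex poly"
  assumes "p \<noteq> 0" "\<And>i. coeff p i \<noteq> 0 \<Longrightarrow> m \<le> i \<and> i \<le> n"
  shows "root_count (- {0}) p \<le> n - m"
proof -
  have "monom 1 m dvd p" using assms(2) by (auto simp: monom_1_dvd_iff' not_le[symmetric])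
  then have "m \<le> order 0 p" using assms(1) by (simp add: monom_1_dvd_iff)
  moreover have "degree p \<le> n" using assms by (meson leading_coeff_0_iff)
  ultimately show ?thesis using root_count_nonzero_add_order[OF assms(1)] by linarith
qed

lemma root_count_nonzero_eq:
  fixes p :: "complex poly"
  assumes "coeff p m \<noteq> 0" "coeff p n \<noteq> 0" "\<And>i. coeff p i \<noteq> 0 \<Longrightarrow> m \<le> i \<and> i \<le> n"
  shows "root_count (- {0}) p = n - m"
proof -
  have p: "p \<noteq> 0" using assms by auto
  have "monom 1 (order 0 p) dvd p" using p by (simp add: monom_1_dvd_iff)
  then have "order 0 p \<le> m" using assms(1) by (meson monom_1_dvd_iff' not_le)
  moreover have "n \<le> degree p" using assms(2) by (rule le_degree)
  ultimately have "n - m \<le> root_count (- {0}) p" using root_count_nonzero_add_order[OF p] by linarith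
  then show ?thesis using root_count_nonzero_le[OF p assms(3)] by force
qed

section \<open>Semicontinuity of the number of roots\<close>

lemma zorder_poly_eq_order:
  fixes p :: "complex poly"
  assumes "p \<noteq> 0"
  shows "zorder (poly p) z = int (order z p)"
proof -
  obtain q where q: "p = [:-z, 1:] ^ order z p * q" "\<not> [:-z, 1:] dvd q"
    using order_decomp[OF assms] by blast
  show ?thesis
  proof (rule zorder_eqI[of UNIV])
    show "poly q z \<noteq> 0" using q(2) by (simp add: poly_eq_0_iff_dvd)
    show "poly p w = poly q w * (w - z) powi int (order z p)" if "w \<noteq> z" for w
      by (subst q(1)) (simp add: poly_power mult.commute)
  qed (auto intro!: holomorphic_intros)
qed

lemma sum_winding_number_circlepath:
  fixes p :: "complex poly"
  assumes "r > 0" and nz: "\<And>z. z \<in> sphere t r \<Longrightarrow> poly p z \<noteq> 0"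
  shows "(\<Sum>z\<in>{z. poly p z = 0}. winding_number (circlepath t r) z * zorder (poly p) z) =
    of_nat (root_count (ball t r) p)"
proof -
  have "t + of_real r \<in> sphere t r" using assms(1) by (simp add: dist_norm)
  then have "p \<noteq> 0" using nz by force
  have "winding_number (circlepath t r) z = (if z \<in> ball t r then 1 else 0)" if "poly p z = 0" for z
  proof (cases "z \<in> ball t r")
    case True
    then show ?thesis
      using winding_number_circlepath[of z t r] by (simp add: dist_norm norm_minus_commute)
  next
    case False
    then have "z \<notin> cball t r" using nz[of z] that by force
    then show ?thesis
      using False winding_number_zero_outside[of "circlepath t r" "cball t r" z] assms(1) by simp
  qed
  then have "(\<Sum>z\<in>{z. poly p z = 0}. winding_number (circlepath t r) z * zorder (poly p) z) =
      (\<Sum>z\<in>{z. poly p z = 0}. if z \<in> ball t r then of_nat (order z p) else 0)"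
    using \<open>p \<noteq> 0\<close> by (intro sum.cong) (auto simp: zorder_poly_eq_order)
  also have "\<dots> = (\<Sum>z\<in>{z. poly p z = 0} \<inter> ball t r. of_nat (order z p))"
    using poly_roots_finite[OF \<open>p \<noteq> 0\<close>] by (simp add: sum.inter_restrict)
  also have "{z. poly p z = 0} \<inter> ball t r = {z\<in>ball t r. poly p z = 0}" by auto
  finally show ?thesis by (simp add: root_count_def)
qed

lemma root_count_ball_eq_if_close:
  fixes p q :: "complex poly"
  assumes "r > 0" and close: "\<And>z. z \<in> sphere t r \<Longrightarrow> cmod (poly q z - poly p z) < cmod (poly p z)"
  shows "root_count (ball t r) q = root_count (ball t r) p"
proof -
  have nz: "poly p z \<noteq> 0" "poly q z \<noteq> 0" if "z \<in> sphere t r" for z using close[OF that] by auto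
  have "t + of_real r \<in> sphere t r" using assms(1) by (simp add: dist_norm)
  then have "p \<noteq> 0" "q \<noteq> 0" using nz by force+
  have "(\<Sum>z\<in>{z\<in>UNIV. poly p z + poly (q - p) z = 0}.
        winding_number (circlepath t r) z * zorder (\<lambda>z. poly p z + poly (q - p) z) z) =
      (\<Sum>z\<in>{z\<in>UNIV. poly p z = 0}. winding_number (circlepath t r) z * zorder (poly p) z)"
    by (rule Rouche_theorem)
      (use assms(1) \<open>p \<noteq> 0\<close> \<open>q \<noteq> 0\<close> poly_roots_finite close in \<open>auto intro!: holomorphic_intros\<close>)
  then have "(\<Sum>z\<in>{z. poly q z = 0}. winding_number (circlepath t r) z * zorder (poly q) z) =
      (\<Sum>z\<in>{z. poly p z = 0}. winding_number (circlepath t r) z * zorder (poly p) z)" by simp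
  then have "complex_of_nat (root_count (ball t r) q) = of_nat (root_count (ball t r) p)"
    using sum_winding_number_circlepath[OF assms(1) nz(1)] sum_winding_number_circlepath[OF assms(1) nz(2)]
    by simp
  then show ?thesis by (simp only: of_nat_eq_iff)
qed

lemma eventually_norm_poly_diff_less:
  fixes p :: "'a :: {real_normed_field} poly" and q :: "'b \<Rightarrow> 'a poly"
  assumes lim: "\<And>i. ((\<lambda>x. coeff (q x) i) \<longlongrightarrow> coeff p i) F" and deg: "\<And>x. degree (q x) \<le> N" and "\<mu> > 0"
  shows "\<forall>\<^sub>F x in F. \<forall>z. norm z \<le> R \<longrightarrow> norm (poly (q x) z - poly p z) < \<mu>"
proof -
  define K where "K = max N (degree p)"
  have "((\<lambda>x. \<Sum>i\<le>K. norm (coeff (q x) i - coeff p i) * R ^ i) \<longlongrightarrow>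
      (\<Sum>i\<le>K. norm (coeff p i - coeff p i) * R ^ i)) F"
    by (intro tendsto_intros lim)
  then have "\<forall>\<^sub>F x in F. (\<Sum>i\<le>K. norm (coeff (q x) i - coeff p i) * R ^ i) < \<mu>"
    using assms(3) by (auto dest: order_tendstoD(2))
  then show ?thesis
  proof eventually_elim
    case (elim x)
    have "norm (poly (q x) z - poly p z) < \<mu>" if z: "norm z \<le> R" for z
    proof -
      have "degree (q x - p) \<le> K" using deg[of x] by (intro degree_diff_le) (auto simp: K_def)
      then have "poly (q x - p) z = (\<Sum>i\<le>K. coeff (q x - p) i * z ^ i)"
        unfolding poly_altdef by (intro sum.mono_neutral_left) (auto simp: coeff_eq_0 simp del: coeff_diff)
      then have "norm (poly (q x) z - poly p z) \<le> (\<Sum>i\<le>K. norm (coeff (q x - p) i * z ^ i))"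
        by (metis norm_sum poly_diff)
      also have "\<dots> \<le> (\<Sum>i\<le>K. norm (coeff (q x) i - coeff p i) * R ^ i)"
        using z by (intro sum_mono) (simp add: norm_mult norm_power mult_left_mono power_mono)
      finally show ?thesis using elim by linarith
    qed
    then show ?case by blast
  qed
qed

lemma exists_sphere_avoiding_roots:
  fixes p :: "complex poly"
  assumes "p \<noteq> 0" "\<epsilon> > 0"
  obtains r \<mu> where "0 < r" "r < \<epsilon>" "\<mu> > 0" "\<And>z. z \<in> sphere t r \<Longrightarrow> \<mu> \<le> cmod (poly p z)"
proof -
  obtain d where d: "d > 0" "\<And>z. poly p z = 0 \<Longrightarrow> z \<noteq> t \<Longrightarrow> d \<le> dist t z"
    using finite_set_avoid[OF poly_roots_finite[OF assms(1)], of t] by auto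
  define r where "r = min \<epsilon> d / 2"
  have r: "0 < r" "r < \<epsilon>" "r < d" using assms(2) d(1) by (auto simp: r_def)
  have nz: "poly p z \<noteq> 0" if "z \<in> sphere t r" for z using that r d(2)[of z] by force
  have "compact (sphere t r)" "sphere t r \<noteq> {}" using r by auto
  moreover have "continuous_on (sphere t r) (\<lambda>z. cmod (poly p z))" by (intro continuous_intros)
  ultimately obtain z0 where "z0 \<in> sphere t r" "\<And>z. z \<in> sphere t r \<Longrightarrow> cmod (poly p z0) \<le> cmod (poly p z)"
    by (meson continuous_attains_inf)
  then show ?thesis using that[of r "cmod (poly p z0)"] r nz by auto
qed

lemma eventually_order_le_root_count_ball:
  fixes p :: "complex poly" and q :: "'b \<Rightarrow> complex poly"
  assumes lim: "\<And>i. ((\<lambda>x. coeff (q x) i) \<longlongrightarrow> coeff p i) F" and deg: "\<And>x. degree (q x) \<le> N"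
    and "p \<noteq> 0" "\<epsilon> > 0"
  shows "\<forall>\<^sub>F x in F. q x \<noteq> 0 \<and> order t p \<le> root_count (ball t \<epsilon>) (q x)"
proof -
  obtain r \<mu> where r: "0 < r" "r < \<epsilon>" and \<mu>: "\<mu> > 0" "\<And>z. z \<in> sphere t r \<Longrightarrow> \<mu> \<le> cmod (poly p z)"
    using exists_sphere_avoiding_roots[OF assms(3,4)] by metis
  have "\<forall>\<^sub>F x in F. \<forall>z. cmod z \<le> cmod t + r \<longrightarrow> cmod (poly (q x) z - poly p z) < \<mu>"
    by (rule eventually_norm_poly_diff_less[OF lim deg \<mu>(1)])
  then show ?thesis
  proof eventually_elim
    case (elim x)
    have close: "cmod (poly (q x) z - poly p z) < cmod (poly p z)" if "z \<in> sphere t r" for z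
    proof -
      have "cmod z \<le> cmod t + r"
        using that norm_triangle_sub[of z t] by (simp add: dist_norm norm_minus_commute)
      then show ?thesis using elim \<mu>(2)[OF that] by fastforce
    qed
    have "t + of_real r \<in> sphere t r" using r by (simp add: dist_norm)
    from close[OF this] have "q x \<noteq> 0" by auto
    moreover have "order t p \<le> root_count (ball t r) p" using assms(3) r by (intro order_le_root_count) auto
    moreover have "root_count (ball t r) p = root_count (ball t r) (q x)"
      using root_count_ball_eq_if_close[OF r(1) close] by simp
    moreover have "\<dots> \<le> root_count (ball t \<epsilon>) (q x)" using \<open>q x \<noteq> 0\<close> r by (intro root_count_mono) auto
    ultimately show ?case by simp
  qed
qed

lemma finite_disjoint_balls_subset:
  fixes T :: "'a :: metric_space set"
  assumes "finite T" "T \<subseteq> U" "open U"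
  obtains \<epsilon> where "\<epsilon> > 0" "\<And>t. t \<in> T \<Longrightarrow> ball t \<epsilon> \<subseteq> U" "disjoint_family_on (\<lambda>t. ball t \<epsilon>) T"
proof -
  have "\<forall>\<^sub>F \<epsilon> in at_right 0. \<forall>t\<in>T. ball t \<epsilon> \<subseteq> U"
  proof (intro eventually_ball_finite assms ballI)
    fix t assume "t \<in> T"
    then obtain e where "e > 0" "ball t e \<subseteq> U" using assms openE by blast
    then show "\<forall>\<^sub>F \<epsilon> in at_right 0. ball t \<epsilon> \<subseteq> U"
      unfolding eventually_at_right_field by (intro exI[of _ e]) (auto simp: subset_eq)
  qed
  moreover have "\<forall>\<^sub>F \<epsilon> in at_right 0. \<forall>t\<in>T. \<forall>t'\<in>T. t \<noteq> t' \<longrightarrow> \<epsilon> + \<epsilon> \<le> dist t t'"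
  proof (intro eventually_ball_finite assms ballI)
    fix t t' :: 'a
    show "\<forall>\<^sub>F \<epsilon> in at_right 0. t \<noteq> t' \<longrightarrow> \<epsilon> + \<epsilon> \<le> dist t t'"
    proof (cases "t = t'")
      case False
      then show ?thesis
        unfolding eventually_at_right_field by (intro exI[of _ "dist t t' / 2"]) auto
    qed simp
  qed
  moreover have "\<forall>\<^sub>F \<epsilon> in at_right 0. (0 :: real) < \<epsilon>" by (rule eventually_at_right_less)
  ultimately have "\<forall>\<^sub>F \<epsilon> in at_right 0. 0 < \<epsilon> \<and> (\<forall>t\<in>T. ball t \<epsilon> \<subseteq> U) \<and>
      (\<forall>t\<in>T. \<forall>t'\<in>T. t \<noteq> t' \<longrightarrow> \<epsilon> + \<epsilon> \<le> dist t t')"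
    by eventually_elim blast
  from eventually_happens'[OF trivial_limit_at_right_real this]
  obtain \<epsilon> :: real where "0 < \<epsilon>" "\<forall>t\<in>T. ball t \<epsilon> \<subseteq> U"
      "\<forall>t\<in>T. \<forall>t'\<in>T. t \<noteq> t' \<longrightarrow> \<epsilon> + \<epsilon> \<le> dist t t'"
    by (elim exE conjE)
  then show ?thesis using that[of \<epsilon>] by (simp add: disjoint_family_on_def disjoint_ballI)
qed

lemma eventually_root_count_ge:
  fixes p :: "complex poly" and q :: "'b \<Rightarrow> complex poly"
  assumes lim: "\<And>i. ((\<lambda>x. coeff (q x) i) \<longlongrightarrow> coeff p i) F" and deg: "\<And>x. degree (q x) \<le> N"
    and "p \<noteq> 0" "open U"
  shows "\<forall>\<^sub>F x in F. q x \<noteq> 0 \<and> root_count U p \<le> root_count U (q x)"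
proof -
  define T where "T = {t\<in>U. poly p t = 0}"
  have T: "finite T" "T \<subseteq> U" using poly_roots_finite[OF assms(3)] by (auto simp: T_def)
  obtain \<epsilon> where \<epsilon>: "\<epsilon> > 0" "\<And>t. t \<in> T \<Longrightarrow> ball t \<epsilon> \<subseteq> U" "disjoint_family_on (\<lambda>t. ball t \<epsilon>) T"
    using finite_disjoint_balls_subset[OF T assms(4)] by metis
  have "\<forall>\<^sub>F x in F. \<forall>t\<in>T. q x \<noteq> 0 \<and> order t p \<le> root_count (ball t \<epsilon>) (q x)"
    using assms(3) \<epsilon>(1) T(1) lim deg by (intro eventually_ball_finite ballI eventually_order_le_root_count_ball)
  moreover have "\<forall>\<^sub>F x in F. q x \<noteq> 0"
    by (rule eventually_mono[OF eventually_order_le_root_count_ball[where t = 0, OF lim deg assms(3) \<epsilon>(1)]]) simp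
  ultimately show ?thesis
  proof eventually_elim
    case (elim x)
    have "root_count U p \<le> (\<Sum>t\<in>T. root_count (ball t \<epsilon>) (q x))"
      unfolding root_count_def[of U] T_def[symmetric] using elim by (intro sum_mono) auto
    also have "\<dots> = root_count (\<Union>t\<in>T. ball t \<epsilon>) (q x)"
      using elim T(1) \<epsilon>(3) by (intro root_count_UN_disjoint[symmetric])
    also have "\<dots> \<le> root_count U (q x)" using elim \<epsilon>(2) by (intro root_count_mono) auto
    finally show ?case using elim by simp
  qed
qed

section \<open>The arguments of the roots\<close>

lemma nz_root_count_eq_root_count: "nz_root_count p = root_count (- {0}) p"
  unfolding nz_root_count_def root_count_def nonzero_roots_def by (intro sum.cong) auto

lemma nz_root_count_eq_add:
  assumes "p \<noteq> 0" "U \<inter> V = {}" "0 \<notin> U" "0 \<notin> V" "nonzero_roots p \<subseteq> U \<union> V"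
  shows "nz_root_count p = root_count U p + root_count V p"
proof -
  have "root_count (- {0}) p = root_count (U \<union> V) p"
  proof (rule root_count_cong)
    show "z \<in> - {0} \<longleftrightarrow> z \<in> U \<union> V" if "poly p z = 0" for z
      using assms(3-5) that by (auto simp: nonzero_roots_def)
  qed
  then show ?thesis using root_count_Un_disjoint[OF assms(1,2)] by (simp add: nz_root_count_eq_root_count)
qed

lemma N_arg_eq_root_count:
  "N_arg \<alpha> \<beta> p = root_count {z. z \<noteq> 0 \<and> \<alpha> \<le> arg02pi z \<and> arg02pi z \<le> \<beta>} p"
  unfolding N_arg_def root_count_def nonzero_roots_def by (intro sum.cong) auto

lemma finite_nonzero_roots: "p \<noteq> 0 \<Longrightarrow> finite (nonzero_roots p)"
  using poly_roots_finite[of p] by (simp add: nonzero_roots_def)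

lemma nonzero_roots_pcompose_scale:
  assumes "c \<noteq> 0"
  shows "nonzero_roots (pcompose p [:0, c:]) = (*) (inverse c) ` nonzero_roots p"
proof (intro equalityI subsetI)
  fix z assume "z \<in> nonzero_roots (pcompose p [:0, c:])"
  then show "z \<in> (*) (inverse c) ` nonzero_roots p"
    using assms by (intro image_eqI[of _ _ "c * z"]) (auto simp: nonzero_roots_def poly_pcompose mult.commute)
qed (use assms in \<open>auto simp: nonzero_roots_def poly_pcompose field_simps\<close>)

lemma bias_ge:
  assumes "p \<noteq> 0" "0 \<le> \<alpha>" "\<alpha> \<le> \<beta>" "\<beta> \<le> 2 * pi"
  shows "\<bar>real (N_arg \<alpha> \<beta> p) - real (nz_root_count p) * (\<beta> - \<alpha>) / (2 * pi)\<bar> \<le> bias p"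
proof -
  let ?D = "\<lambda>ab. \<bar>real (N_arg (fst ab) (snd ab) p) - real (nz_root_count p) * (snd ab - fst ab) / (2 * pi)\<bar>"
  let ?J = "{(\<alpha>, \<beta>). 0 \<le> \<alpha> \<and> \<alpha> \<le> \<beta> \<and> \<beta> \<le> 2 * pi}"
  have "bdd_above (?D ` ?J)"
  proof (rule bdd_aboveI2)
    fix ab assume ab: "ab \<in> ?J"
    have "N_arg (fst ab) (snd ab) p \<le> nz_root_count p"
      unfolding N_arg_def nz_root_count_def using finite_nonzero_roots[OF assms(1)] by (intro sum_mono2) auto
    moreover define x where "x = (snd ab - fst ab) / (2 * pi)"
    have "0 \<le> x" "x \<le> 1" using ab by (auto simp: x_def)
    then have "0 \<le> real (nz_root_count p) * x" "real (nz_root_count p) * x \<le> real (nz_root_count p)"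
      by (simp_all add: mult_left_le)
    ultimately show "?D ab \<le> real (nz_root_count p)" by (simp add: x_def)
  qed
  then have "?D (\<alpha>, \<beta>) \<le> bias p" unfolding bias_def by (intro cSUP_upper) (use assms in auto)
  then show ?thesis by simp
qed

lemma arg02pi_eq_frac: "arg02pi z = 2 * pi * frac (Arg z / (2 * pi))"
proof -
  have "- (2 * pi) < Arg z" "Arg z < 2 * pi" using Arg_bounded[of z] pi_gt_zero by linarith+
  then have "Arg z / (2 * pi) - arg02pi z / (2 * pi) \<in> \<int>" "0 \<le> arg02pi z / (2 * pi)" "arg02pi z / (2 * pi) < 1"
    by (auto simp: arg02pi_def field_simps)
  then have "frac (Arg z / (2 * pi)) = arg02pi z / (2 * pi)" by (simp add: frac_unique_iff)
  then show ?thesis by simp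
qed

lemma arg02pi_nonneg: "0 \<le> arg02pi z" and arg02pi_less: "arg02pi z < 2 * pi"
  using frac_lt_1[of "Arg z / (2 * pi)"] by (simp_all add: arg02pi_eq_frac)

lemma frac_diff_Arg_exp: "frac ((x - Arg (exp w)) / (2 * pi)) = frac ((x - Im w) / (2 * pi))"
proof -
  obtain k where "Arg (exp w) = Im w - of_int k * (2 * pi)" using Arg_exp_diff_2pi[of w] by metis
  then have "(x - Arg (exp w)) / (2 * pi) = (x - Im w) / (2 * pi) + of_int k" by (simp add: field_simps)
  then show ?thesis by simp
qed

lemma frac_diff_Arg_cis_mult:
  assumes "z \<noteq> 0"
  shows "frac ((x - Arg (cis c * z)) / (2 * pi)) = frac ((x - c - Arg z) / (2 * pi))"
  using frac_diff_Arg_exp[of x "\<i> * of_real c + Ln z"] assms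
  by (simp add: exp_add cis_conv_exp Arg_eq_Im_Ln algebra_simps)

lemma arg02pi_exp:
  assumes "0 \<le> Im w" "Im w < 2 * pi"
  shows "arg02pi (exp w) = Im w"
proof -
  have "frac (Arg (exp w) / (2 * pi)) = frac (Im w / (2 * pi))"
    using frac_diff_Arg_exp[of 0 w] frac_neg_eq_iff by fastforce
  also have "\<dots> = Im w / (2 * pi)" using assms by (simp add: frac_eq)
  finally show ?thesis by (simp add: arg02pi_eq_frac)
qed

definition sawtooth :: "complex poly \<Rightarrow> real \<Rightarrow> real" where
  "sawtooth p x = (\<Sum>z\<in>nonzero_roots p. real (order z p) * frac ((x - Arg z) / (2 * pi)))"

lemma sawtooth_increment:
  "sawtooth p (x + y) - sawtooth p x - real (nz_root_count p) * (y / (2 * pi)) \<in> \<int>"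
proof -
  have "frac ((x + y - a) / (2 * pi)) - frac ((x - a) / (2 * pi)) - y / (2 * pi) \<in> \<int>" for a
    by (simp add: frac_def add_divide_distrib diff_divide_distrib)
  then have "(\<Sum>z\<in>nonzero_roots p. real (order z p) *
      (frac ((x + y - Arg z) / (2 * pi)) - frac ((x - Arg z) / (2 * pi)) - y / (2 * pi))) \<in> \<int>"
    by (intro Ints_sum Ints_mult) auto
  then show ?thesis
    by (simp add: sawtooth_def nz_root_count_def right_diff_distrib sum_subtractf sum_distrib_right
        sum_divide_distrib)
qed

lemma sawtooth_periodic: "sawtooth p (x + 2 * pi * of_int k) = sawtooth p x"
proof -
  have "(x + 2 * pi * of_int k - a) / (2 * pi) = (x - a) / (2 * pi) + of_int k" for a by (simp add: field_simps)
  then show ?thesis by (simp only: sawtooth_def frac_add_of_int_right)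
qed

lemma sawtooth_smult: "c \<noteq> 0 \<Longrightarrow> sawtooth (smult c p) x = sawtooth p x"
  by (simp add: sawtooth_def nonzero_roots_def order_smult)

lemma sawtooth_rotate:
  assumes "p \<noteq> 0"
  shows "sawtooth (pcompose p [:0, cis c:]) x = sawtooth p (x + c)"
proof -
  let ?q = "pcompose p [:0, cis c:]"
  have roots: "nonzero_roots ?q = (*) (cis (- c)) ` nonzero_roots p"
    by (simp add: nonzero_roots_pcompose_scale)
  have "sawtooth ?q x = (\<Sum>z\<in>nonzero_roots p.
      real (order (cis (- c) * z) ?q) * frac ((x - Arg (cis (- c) * z)) / (2 * pi)))"
    unfolding sawtooth_def roots by (simp add: sum.reindex inj_on_def)
  also have "\<dots> = sawtooth p (x + c)"
    unfolding sawtooth_def by (intro sum.cong refl)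
      (auto simp: order_pcompose_scale[OF assms] frac_diff_Arg_cis_mult nonzero_roots_def cis_mult
        simp flip: mult.assoc)
  finally show ?thesis .
qed

lemma frac_diff_Arg_eq:
  assumes "0 \<le> x" "x < 2 * pi"
  shows "frac ((x - Arg z) / (2 * pi)) = (x - arg02pi z) / (2 * pi) + of_bool (x < arg02pi z)"
proof -
  have "frac ((x - Arg z) / (2 * pi)) = frac ((x - arg02pi z) / (2 * pi))"
    using frac_diff_simp[of "x / (2 * pi)" "Arg z / (2 * pi)"] by (simp add: arg02pi_eq_frac diff_divide_distrib)
  also have "\<dots> = (x - arg02pi z) / (2 * pi) + of_bool (x < arg02pi z)"
    using assms arg02pi_nonneg[of z] arg02pi_less[of z] by (auto simp: frac_unique_iff field_simps)
  finally show ?thesis .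
qed



lemma N_arg_minus_expected_eq:
  assumes "p \<noteq> 0" "0 \<le> \<alpha>" "\<alpha> \<le> \<beta>" "\<beta> < 2 * pi"
    and "\<And>z. z \<in> nonzero_roots p \<Longrightarrow> arg02pi z \<noteq> \<alpha>"
  shows "real (N_arg \<alpha> \<beta> p) - real (nz_root_count p) * (\<beta> - \<alpha>) / (2 * pi) = sawtooth p \<alpha> - sawtooth p \<beta>"
proof -
  have "frac ((\<alpha> - Arg z) / (2 * pi)) - frac ((\<beta> - Arg z) / (2 * pi)) =
      of_bool (\<alpha> \<le> arg02pi z \<and> arg02pi z \<le> \<beta>) - (\<beta> - \<alpha>) / (2 * pi)" if "z \<in> nonzero_roots p" for z
    using assms(2-4) assms(5)[OF that] by (simp add: frac_diff_Arg_eq) (auto simp: diff_divide_distrib)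
  then have "sawtooth p \<alpha> - sawtooth p \<beta> = (\<Sum>z\<in>nonzero_roots p.
      real (order z p) * (of_bool (\<alpha> \<le> arg02pi z \<and> arg02pi z \<le> \<beta>) - (\<beta> - \<alpha>) / (2 * pi)))"
    by (simp add: sawtooth_def flip: sum_subtractf right_diff_distrib)
  also have "\<dots> = (\<Sum>z\<in>nonzero_roots p. real (order z p) * of_bool (\<alpha> \<le> arg02pi z \<and> arg02pi z \<le> \<beta>)) -
      real (nz_root_count p) * ((\<beta> - \<alpha>) / (2 * pi))"
    by (simp only: right_diff_distrib sum_subtractf nz_root_count_def of_nat_sum sum_distrib_right)
  also have "(\<Sum>z\<in>nonzero_roots p. real (order z p) * of_bool (\<alpha> \<le> arg02pi z \<and> arg02pi z \<le> \<beta>)) =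
      real (N_arg \<alpha> \<beta> p)"
    unfolding N_arg_def sum.inter_filter[OF finite_nonzero_roots[OF assms(1)]] of_nat_sum
    by (intro sum.cong) auto
  finally show ?thesis by simp
qed

lemma exists_generic_offset:
  fixes A :: "real set"
  assumes "finite A" "\<delta> > 0"
  shows "\<exists>x. 0 < x \<and> x < \<delta> \<and> (\<forall>a\<in>A. (x - a) / \<delta> \<notin> \<int>)"
proof -
  define X where "X = (\<lambda>(a, m). a + \<delta> * of_int m) ` (A \<times> UNIV)"
  have "countable X"
    unfolding X_def using assms(1) by (intro countable_image countable_SIGMA) (auto intro: countable_finite)
  then have "\<not> {0<..<\<delta>} \<subseteq> X" using assms(2) uncountable_open_interval countable_subset by blast
  then obtain x where x: "0 < x" "x < \<delta>" "x \<notin> X" by force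
  have "(x - a) / \<delta> \<notin> \<int>" if "a \<in> A" for a
  proof
    assume "(x - a) / \<delta> \<in> \<int>"
    then obtain m where "x = a + \<delta> * of_int m" using assms(2) by (auto elim!: Ints_cases simp: field_simps)
    then show False using x(3) that by (auto simp: X_def)
  qed
  then show ?thesis using x by blast
qed

lemma sawtooth_grid_periodic:
  assumes "M \<noteq> 0"
  shows "periodic_fun_simple (\<lambda>j. sawtooth p (\<phi> + 2 * pi / of_int M * of_int j)) M"
proof
  fix j
  have "\<phi> + 2 * pi / of_int M * of_int (j + M) = \<phi> + 2 * pi / of_int M * of_int j + 2 * pi * of_int 1"
    using assms by (simp add: field_simps)
  then show "sawtooth p (\<phi> + 2 * pi / of_int M * of_int (j + M)) = sawtooth p (\<phi> + 2 * pi / of_int M * of_int j)"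
    by (simp only: sawtooth_periodic)
qed

lemma sawtooth_grid_variance_ge:
  assumes "prime M" "M > 2" and n: "0 < nz_root_count p" "int (nz_root_count p) < M"
  shows "of_int M / 36 \<le> (\<Sum>j\<in>{0..<M}. (sawtooth p (\<phi> + 2 * pi / of_int M * of_int j) - x)\<^sup>2)"
proof (rule variance_ge)
  show "odd M" using assms(1,2) prime_odd_int by blast
  show "coprime (int (nz_root_count p)) M"
    using assms(1) n prime_imp_coprime[of M "int (nz_root_count p)"] zdvd_not_zless
    by (auto simp: coprime_commute)
  show "sawtooth p (\<phi> + 2 * pi / of_int M * of_int (j + 1)) - sawtooth p (\<phi> + 2 * pi / of_int M * of_int j) -
      real (nz_root_count p) / of_int M \<in> \<int>" for j
    using sawtooth_increment[of p "\<phi> + 2 * pi / of_int M * of_int j" "2 * pi / of_int M"]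
    by (simp add: ring_distribs add.assoc)
qed (use assms(2) sawtooth_grid_periodic in auto)

lemma coprime_diff_prime:
  fixes M :: int
  assumes "prime M" "\<bar>a\<bar> * 2 < M" "\<bar>b\<bar> * 2 < M" "a \<noteq> b"
  shows "coprime (a - b) M"
proof -
  have "\<not> M dvd \<bar>a - b\<bar>" using assms(2-4) by (intro zdvd_not_zless) auto
  then show ?thesis using assms(1) prime_imp_coprime[of M "a - b"] by (auto simp: coprime_commute)
qed

lemma exists_large_sawtooth_grid_sum:
  fixes P :: "'i \<Rightarrow> complex poly" and v :: "'i \<Rightarrow> int" and \<phi> :: real
  assumes "finite I" "inj_on v I" "prime M" "M > 2"
    and "\<And>i. i \<in> I \<Longrightarrow> 0 < nz_root_count (P i)" "\<And>i. i \<in> I \<Longrightarrow> int (nz_root_count (P i)) < M"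
    and "\<And>i. i \<in> I \<Longrightarrow> \<bar>v i\<bar> * 2 < M"
  defines "D \<equiv> \<lambda>i j. sawtooth (P i) (\<phi> + 2 * pi / of_int M * of_int j)"
  shows "\<exists>t. \<exists>j\<in>{0..<M}. sqrt (real (card I)) / 6 \<le> \<bar>\<Sum>i\<in>I. D i (v i * t) - D i (j + v i * t)\<bar>"
proof -
  have "\<exists>t. \<exists>j\<in>{0..<M}. real (card I) * (1 / 36) \<le> (\<Sum>i\<in>I. D i (j + v i * t) - D i (v i * t))\<^sup>2"
  proof (rule exists_large_sum_of_shifts)
    show "coprime (v i' - v i) M" if "i \<in> I" "i' \<in> I" "i \<noteq> i'" for i i'
      using that assms(3,7) inj_onD[OF assms(2), of i' i] by (intro coprime_diff_prime) auto
  qed (use assms sawtooth_grid_periodic sawtooth_grid_variance_ge in auto)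
  then obtain t j where j: "j \<in> {0..<M}"
    and large: "real (card I) / 36 \<le> (\<Sum>i\<in>I. D i (j + v i * t) - D i (v i * t))\<^sup>2" by auto
  have "sqrt (real (card I)) / 6 = sqrt (real (card I) / 36)" by (simp add: real_sqrt_divide)
  also have "\<dots> \<le> \<bar>\<Sum>i\<in>I. D i (j + v i * t) - D i (v i * t)\<bar>" using real_sqrt_le_mono[OF large] by simp
  also have "\<dots> = \<bar>\<Sum>i\<in>I. D i (v i * t) - D i (j + v i * t)\<bar>" by (simp add: sum_subtractf abs_minus_commute)
  finally show ?thesis using j by blast
qed

lemma grid_offset_notin_Ints:
  fixes x a \<delta> :: real
  assumes "(x - a) / \<delta> \<notin> \<int>" "\<delta> \<noteq> 0" "M \<noteq> 0"
  shows "(x + \<delta> * of_int k - a) / (\<delta> * of_int M) \<notin> \<int>"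
proof
  assume "(x + \<delta> * of_int k - a) / (\<delta> * of_int M) \<in> \<int>"
  then obtain l where "x + \<delta> * of_int k - a = \<delta> * of_int M * of_int l"
    using assms(2,3) by (auto elim!: Ints_cases simp: field_simps)
  then have "(x - a) / \<delta> = of_int (M * l - k)" using assms(2) by (simp add: field_simps)
  then show False using assms(1) by (metis Ints_of_int)
qed

lemma exists_large_sawtooth_sum:
  fixes P :: "'i \<Rightarrow> complex poly" and v :: "'i \<Rightarrow> int"
  assumes "finite I" "inj_on v I" and pos: "\<And>i. i \<in> I \<Longrightarrow> 0 < nz_root_count (P i)"
  obtains \<alpha> \<beta> \<theta> where "0 \<le> \<alpha>" "\<alpha> \<le> \<beta>" "\<beta> < 2 * pi"
    "\<And>i z. i \<in> I \<Longrightarrow> z \<in> nonzero_roots (P i) \<Longrightarrow> (\<alpha> + of_int (v i) * \<theta> - Arg z) / (2 * pi) \<notin> \<int>"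
    "\<And>i z. i \<in> I \<Longrightarrow> z \<in> nonzero_roots (P i) \<Longrightarrow> (\<beta> + of_int (v i) * \<theta> - Arg z) / (2 * pi) \<notin> \<int>"
    "sqrt (real (card I)) / 6 \<le>
      \<bar>\<Sum>i\<in>I. sawtooth (P i) (\<alpha> + of_int (v i) * \<theta>) - sawtooth (P i) (\<beta> + of_int (v i) * \<theta>)\<bar>"
proof -
  define bound where "bound i = nz_root_count (P i) + nat \<bar>v i\<bar> * 2" for i
  obtain m where m: "prime m" "(\<Sum>i\<in>I. bound i) + 2 < m" using bigger_prime by blast
  define M where "M = int m"
  have M: "prime M" "M > 2" using m by (auto simp: M_def)
  have bound: "int (nz_root_count (P i)) < M" "\<bar>v i\<bar> * 2 < M" if "i \<in> I" for i
    using member_le_sum[OF that, of bound] assms(1) m(2) by (simp_all add: bound_def M_def)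
  define \<delta> where "\<delta> = 2 * pi / of_int M"
  have \<delta>: "\<delta> > 0" "\<delta> * of_int M = 2 * pi" using M(2) by (simp_all add: \<delta>_def)
  have "finite (nonzero_roots (P i))" if "i \<in> I" for i
    using pos[OF that] by (auto simp: nz_root_count_def intro: ccontr)
  then obtain \<phi> where \<phi>: "0 < \<phi>" "\<phi> < \<delta>"
    and generic: "\<And>i z. i \<in> I \<Longrightarrow> z \<in> nonzero_roots (P i) \<Longrightarrow> (\<phi> - Arg z) / \<delta> \<notin> \<int>"
    using exists_generic_offset[of "\<Union>i\<in>I. Arg ` nonzero_roots (P i)" \<delta>] assms(1) \<delta>(1) by auto
  have "\<exists>t. \<exists>j\<in>{0..<M}. sqrt (real (card I)) / 6 \<le> \<bar>\<Sum>i\<in>I.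
      sawtooth (P i) (\<phi> + \<delta> * of_int (v i * t)) - sawtooth (P i) (\<phi> + \<delta> * of_int (j + v i * t))\<bar>"
    unfolding \<delta>_def by (rule exists_large_sawtooth_grid_sum) (use assms M bound in auto)
  then obtain t j where j: "0 \<le> j" "j < M" and large: "sqrt (real (card I)) / 6 \<le> \<bar>\<Sum>i\<in>I.
      sawtooth (P i) (\<phi> + \<delta> * of_int (v i * t)) - sawtooth (P i) (\<phi> + \<delta> * of_int (j + v i * t))\<bar>"
    by auto
  have grid: "\<phi> + of_int (v i) * (\<delta> * of_int t) = \<phi> + \<delta> * of_int (v i * t)"
    "\<phi> + \<delta> * of_int j + of_int (v i) * (\<delta> * of_int t) = \<phi> + \<delta> * of_int (j + v i * t)" for i
    by (simp_all add: algebra_simps)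
  show ?thesis
  proof (rule that[of \<phi> "\<phi> + \<delta> * of_int j" "\<delta> * of_int t", unfolded grid \<delta>(2)[symmetric]])
    show "\<phi> + \<delta> * of_int j < \<delta> * of_int M"
      using \<phi>(2) \<delta>(1) j(2) mult_left_mono[of "of_int (j + 1)" "of_int M" \<delta>] by (simp add: algebra_simps)
    fix i z assume "i \<in> I" "z \<in> nonzero_roots (P i)"
    then show "(\<phi> + \<delta> * of_int (v i * t) - Arg z) / (\<delta> * of_int M) \<notin> \<int>"
      "(\<phi> + \<delta> * of_int (j + v i * t) - Arg z) / (\<delta> * of_int M) \<notin> \<int>"
      using generic \<delta>(1) M(2) by (intro grid_offset_notin_Ints; auto)+
  qed (use \<phi>(1) \<delta>(1) j(1) large in auto)
qed

definition sector :: "real \<Rightarrow> real \<Rightarrow> complex set" where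
  "sector \<alpha> \<beta> = exp ` {w. \<alpha> < Im w \<and> Im w < \<beta>}"

lemma open_sector: "open (sector \<alpha> \<beta>)"
  unfolding sector_def
proof (rule open_mapping_thm[of exp UNIV])
  show "\<not> (exp :: complex \<Rightarrow> complex) constant_on UNIV"
    unfolding constant_on_def by (metis UNIV_I exp_zero exp_pi_i one_neq_neg_one)
  show "open {w. \<alpha> < Im w \<and> Im w < \<beta>}"
    by (intro open_Collect_conj open_Collect_less continuous_intros)
qed (auto intro: holomorphic_intros)

lemma sector_scale:
  assumes "z \<in> sector \<alpha> \<beta>" "r > 0"
  shows "of_real r * z \<in> sector \<alpha> \<beta>"
proof -
  obtain w where "z = exp w" "\<alpha> < Im w" "Im w < \<beta>" using assms(1) by (auto simp: sector_def)
  then show ?thesis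
    unfolding sector_def using assms(2)
    by (intro image_eqI[of _ _ "of_real (ln r) + w"]) (simp_all add: exp_add exp_of_real)
qed

lemma exists_exp_arg02pi:
  assumes "z \<noteq> 0"
  obtains w where "z = exp w" "Im w = arg02pi z"
proof
  show "z = exp (Ln z + \<i> * of_real (arg02pi z - Arg z))"
    using assms by (simp add: arg02pi_def exp_add mult.commute[of \<i>])
  show "Im (Ln z + \<i> * of_real (arg02pi z - Arg z)) = arg02pi z"
    using assms by (simp add: Arg_eq_Im_Ln)
qed

lemma mem_sector_iff:
  assumes "0 \<le> \<alpha>" "\<beta> \<le> 2 * pi"
  shows "z \<in> sector \<alpha> \<beta> \<longleftrightarrow> z \<noteq> 0 \<and> \<alpha> < arg02pi z \<and> arg02pi z < \<beta>"
proof
  assume "z \<in> sector \<alpha> \<beta>"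
  then show "z \<noteq> 0 \<and> \<alpha> < arg02pi z \<and> arg02pi z < \<beta>" using assms by (auto simp: sector_def arg02pi_exp)
next
  assume z: "z \<noteq> 0 \<and> \<alpha> < arg02pi z \<and> arg02pi z < \<beta>"
  then obtain w where "z = exp w" "Im w = arg02pi z" using exists_exp_arg02pi by blast
  then show "z \<in> sector \<alpha> \<beta>" using z by (auto simp: sector_def)
qed

lemma mem_opposite_sector_iff:
  assumes "0 \<le> \<alpha>" "\<alpha> \<le> \<beta>" "\<beta> < 2 * pi"
  shows "z \<in> sector \<beta> (\<alpha> + 2 * pi) \<longleftrightarrow> z \<noteq> 0 \<and> (arg02pi z < \<alpha> \<or> \<beta> < arg02pi z)"
proof
  assume "z \<in> sector \<beta> (\<alpha> + 2 * pi)"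
  then obtain w where w: "z = exp w" "\<beta> < Im w" "Im w < \<alpha> + 2 * pi" by (auto simp: sector_def)
  have "arg02pi z = (if Im w < 2 * pi then Im w else Im w - 2 * pi)"
    using assms w arg02pi_exp[of w] arg02pi_exp[of "w - 2 * of_real pi * \<i>"] by (simp add: exp_diff)
  then show "z \<noteq> 0 \<and> (arg02pi z < \<alpha> \<or> \<beta> < arg02pi z)" using w by (auto split: if_splits)
next
  assume z: "z \<noteq> 0 \<and> (arg02pi z < \<alpha> \<or> \<beta> < arg02pi z)"
  then obtain w where w: "z = exp w" "Im w = arg02pi z" using exists_exp_arg02pi by blast
  then have w': "z = exp (w + 2 * of_real pi * \<i>)" by (simp add: exp_add)
  from z consider "arg02pi z < \<alpha>" | "\<beta> < arg02pi z" by blast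
  then show "z \<in> sector \<beta> (\<alpha> + 2 * pi)"
  proof cases
    case 1
    then show ?thesis
      unfolding sector_def using assms w(2) arg02pi_nonneg[of z] by (intro image_eqI[where f = exp, OF w']) simp
  next
    case 2
    then show ?thesis
      unfolding sector_def using assms w(2) arg02pi_less[of z] by (intro image_eqI[where f = exp, OF w(1)]) simp
  qed
qed

section \<open>The lower boundary of a planar point set\<close>

locale planar_points =
  fixes S :: "'a set" and deg :: "'a \<Rightarrow> nat" and ht :: "'a \<Rightarrow> int"
  assumes finite_points: "finite S" and points_nonempty: "S \<noteq> {}"
    and inj_on_coordinates: "inj_on (\<lambda>p. (deg p, ht p)) S"
begin

text \<open>Under the substitution \<open>x = y\<^sup>e u\<close> a monomial \<open>x\<^sup>i y\<^sup>j\<close> becomes \<open>y\<^sup>w u\<^sup>i\<close>, where \<open>w\<close> is the weight of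
  \<open>(i, j)\<close> for \<open>e\<close>; so \<open>e\<close> is minus the slope of its lower face.\<close>

definition weight :: "real \<Rightarrow> 'a \<Rightarrow> real" where
  "weight e p = of_int (ht p) + e * real (deg p)"

definition face :: "real \<Rightarrow> 'a set" where
  "face e = {p\<in>S. \<forall>q\<in>S. weight e p \<le> weight e q}"

definition lo :: "real \<Rightarrow> nat" where
  "lo e = Min (deg ` face e)"

definition hi :: "real \<Rightarrow> nat" where
  "hi e = Max (deg ` face e)"

definition slopes :: "real set" where
  "slopes = {e. lo e < hi e}"

definition lower_vertices :: "'a set" where
  "lower_vertices = {v\<in>S. \<exists>l. \<forall>q\<in>S - {v}. weight l v < weight l q}"

lemma face_subset: "face e \<subseteq> S"
  by (auto simp: face_def)

lemma finite_face: "finite (face e)"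
  using face_subset finite_points by (rule finite_subset)

lemma mem_face_iff: "p \<in> face e \<longleftrightarrow> p \<in> S \<and> weight e p = Min (weight e ` S)"
proof -
  have "weight e p = Min (weight e ` S) \<longleftrightarrow> (\<forall>q\<in>S. weight e p \<le> weight e q)" if "p \<in> S"
    using that finite_points by (auto intro: Min_eqI[symmetric])
  then show ?thesis by (auto simp: face_def)
qed

lemma face_nonempty: "face e \<noteq> {}"
proof -
  have "Min (weight e ` S) \<in> weight e ` S" using finite_points points_nonempty by simp
  then show ?thesis using mem_face_iff by (metis empty_iff imageE)
qed

lemma face_weight_eq: "p \<in> face e \<Longrightarrow> q \<in> face e \<Longrightarrow> weight e p = weight e q"
  by (simp add: mem_face_iff)

lemma inj_on_deg_face: "inj_on deg (face e)"
proof (rule inj_onI)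
  fix p q assume pq: "p \<in> face e" "q \<in> face e" "deg p = deg q"
  then have "ht p = ht q" using face_weight_eq[of p e q] by (simp add: weight_def)
  then show "p = q" using pq face_subset inj_onD[OF inj_on_coordinates, of p q] by auto
qed

lemma deg_face_bounds: "p \<in> face e \<Longrightarrow> lo e \<le> deg p \<and> deg p \<le> hi e"
  by (simp add: lo_def hi_def finite_face)

lemma face_endpoints:
  obtains p q where "p \<in> face e" "deg p = lo e" "q \<in> face e" "deg q = hi e"
proof -
  have "lo e \<in> deg ` face e" "hi e \<in> deg ` face e"
    unfolding lo_def hi_def using finite_face face_nonempty by simp_all
  then show ?thesis using that by force
qed

lemma deg_face_antimono:
  assumes "e < e'" "p \<in> face e" "q \<in> face e'"
  shows "deg q \<le> deg p"
proof -
  have "weight e p \<le> weight e q" "weight e' q \<le> weight e' p" using assms by (auto simp: face_def)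
  then have "(e' - e) * (real (deg q) - real (deg p)) \<le> 0" by (simp add: weight_def algebra_simps)
  then show ?thesis using assms(1) by (simp add: mult_le_0_iff)
qed

definition crossing :: "'a \<Rightarrow> 'a \<Rightarrow> real" where
  "crossing p q = of_int (ht p - ht q) / (real (deg q) - real (deg p))"

lemma weight_diff_eq:
  assumes "deg p \<noteq> deg q"
  shows "weight e p - weight e q = (real (deg q) - real (deg p)) * (crossing p q - e)"
  using assms by (simp add: weight_def crossing_def field_simps)

lemma weight_le_iff_crossing:
  assumes "deg p < deg q"
  shows "weight e p \<le> weight e q \<longleftrightarrow> crossing p q \<le> e" "weight e q \<le> weight e p \<longleftrightarrow> e \<le> crossing p q"
  using weight_diff_eq[of p q e] assms by (smt (verit) mult_le_0_iff of_nat_less_iff zero_le_mult_iff)+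

lemma slope_eq_crossing:
  assumes "e \<in> slopes"
  obtains p q where "p \<in> S" "q \<in> S" "deg p < deg q" "e = crossing p q"
proof -
  obtain p q where pq: "p \<in> face e" "deg p = lo e" "q \<in> face e" "deg q = hi e" by (rule face_endpoints)
  moreover from this have "deg p < deg q" using assms by (simp add: slopes_def)
  moreover from this have "e = crossing p q"
    using weight_diff_eq[of p q e] face_weight_eq[OF pq(1,3)] by simp
  ultimately show ?thesis using that face_subset by blast
qed

lemma finite_slopes: "finite slopes"
proof (rule finite_subset)
  show "slopes \<subseteq> (\<lambda>(p, q). crossing p q) ` (S \<times> S)"
  proof
    fix e assume "e \<in> slopes"
    then obtain p q where "p \<in> S" "q \<in> S" "e = crossing p q" by (rule slope_eq_crossing)
    then show "e \<in> (\<lambda>(p, q). crossing p q) ` (S \<times> S)" by auto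
  qed
qed (use finite_points in auto)

lemma fact_mult_slope_in_Ints:
  assumes "e \<in> slopes"
  shows "fact (Max (deg ` S)) * e \<in> \<int>"
proof -
  obtain p q where pq: "p \<in> S" "q \<in> S" "deg p < deg q" "e = crossing p q"
    using slope_eq_crossing[OF assms] .
  have "deg q \<le> Max (deg ` S)" using pq(2) finite_points by simp
  then have "(deg q - deg p) dvd fact (Max (deg ` S))" using pq(3) by (intro dvd_fact) auto
  then obtain m :: nat where "fact (Max (deg ` S)) = (deg q - deg p) * m" by (elim dvdE)
  then have "(fact (Max (deg ` S)) :: real) = real (deg q - deg p) * real m"
    by (metis of_nat_fact of_nat_mult)
  then have "fact (Max (deg ` S)) * e = of_int (int m * (ht p - ht q))"
    using pq(3,4) by (simp add: crossing_def of_nat_diff)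
  then show ?thesis by (metis Ints_of_int)
qed

text \<open>The edge over \<open>[i, i + 1]\<close> lies on the line whose \<open>e\<close> is the minimax of the crossings of a point to
  the left with a point to the right.\<close>

lemma exists_slope_over:
  assumes "p0 \<in> S" "deg p0 \<le> i" "q0 \<in> S" "i < deg q0"
  shows "\<exists>e\<in>slopes. lo e \<le> i \<and> i < hi e"
proof -
  define A where "A = {p\<in>S. deg p \<le> i}"
  define B where "B = {p\<in>S. i < deg p}"
  have fin: "finite A" "finite B" "A \<noteq> {}" "B \<noteq> {}"
    using assms finite_points by (auto simp: A_def B_def)
  have less: "deg p < deg q" if "p \<in> A" "q \<in> B" for p q using that by (auto simp: A_def B_def)
  define m where "m p = Max (crossing p ` B)" for p
  define e where "e = Min (m ` A)"
  have "e \<in> m ` A" unfolding e_def using fin by simp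
  then obtain p where p: "p \<in> A" "e = m p" by auto
  have attained: "m r \<in> crossing r ` B" for r unfolding m_def using fin by simp
  obtain q where q: "q \<in> B" "e = crossing p q" using attained[of p] p by auto
  have right: "weight e p \<le> weight e r" if "r \<in> B" for r
    using weight_le_iff_crossing(1)[OF less[OF p(1) that]] that fin(2) p(2) by (simp add: m_def)
  have left: "weight e p \<le> weight e r" if "r \<in> A" for r
  proof -
    obtain x where x: "x \<in> B" "m r = crossing r x" using attained by auto
    have "e \<le> m r" unfolding e_def using that fin by simp
    then have "weight e x \<le> weight e r" using weight_le_iff_crossing(2)[OF less[OF that x(1)]] x(2) by simp
    then show ?thesis using right[OF x(1)] by simp
  qed
  have "weight e p \<le> weight e r" if "r \<in> S" for r
    using that left[of r] right[of r] by (cases "deg r \<le> i") (auto simp: A_def B_def)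
  then have "p \<in> face e" using p(1) by (simp add: face_def A_def)
  moreover have "weight e q = weight e p" using weight_diff_eq[of p q e] less[OF p(1) q(1)] q(2) by simp
  ultimately have "q \<in> face e" using q(1) by (simp add: mem_face_iff B_def)
  have "lo e \<le> i" "i < hi e"
    using deg_face_bounds[OF \<open>p \<in> face e\<close>] deg_face_bounds[OF \<open>q \<in> face e\<close>] p(1) q(1)
    by (auto simp: A_def B_def)
  then show ?thesis by (intro bexI[of _ e]) (simp_all add: slopes_def)
qed

lemma deg_bounds: "p \<in> S \<Longrightarrow> Min (deg ` S) \<le> deg p \<and> deg p \<le> Max (deg ` S)"
  using finite_points by simp

lemma UN_slope_intervals: "(\<Union>e\<in>slopes. {lo e..<hi e}) = {Min (deg ` S)..<Max (deg ` S)}"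
proof (intro equalityI subsetI)
  fix i assume "i \<in> (\<Union>e\<in>slopes. {lo e..<hi e})"
  then obtain e where e: "lo e \<le> i" "i < hi e" by auto
  obtain p q where "p \<in> face e" "deg p = lo e" "q \<in> face e" "deg q = hi e" by (rule face_endpoints)
  then show "i \<in> {Min (deg ` S)..<Max (deg ` S)}"
    using e deg_bounds[of p] deg_bounds[of q] face_subset[of e] by auto
next
  fix i assume i: "i \<in> {Min (deg ` S)..<Max (deg ` S)}"
  have "Min (deg ` S) \<in> deg ` S" "Max (deg ` S) \<in> deg ` S" using finite_points points_nonempty by auto
  then obtain p q where "p \<in> S" "q \<in> S" "deg p = Min (deg ` S)" "deg q = Max (deg ` S)" by (metis imageE)
  then show "i \<in> (\<Union>e\<in>slopes. {lo e..<hi e})" using exists_slope_over[of p i q] i by auto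
qed

lemma slope_intervals_disjoint:
  assumes "e \<noteq> e'"
  shows "{lo e..<hi e} \<inter> {lo e'..<hi e'} = {}"
  using assms
proof (induction e e' rule: linorder_wlog)
  case (le e e')
  obtain p where "p \<in> face e" "deg p = lo e" using face_endpoints by blast
  moreover obtain q where "q \<in> face e'" "deg q = hi e'" using face_endpoints by blast
  ultimately have "hi e' \<le> lo e" using deg_face_antimono[of e e' p q] le by simp
  then show ?case by auto
qed auto

lemma sum_slope_widths: "(\<Sum>e\<in>slopes. hi e - lo e) = Max (deg ` S) - Min (deg ` S)"
proof -
  have "(\<Sum>e\<in>slopes. hi e - lo e) = (\<Sum>e\<in>slopes. card {lo e..<hi e})" by simp
  also have "\<dots> = card (\<Union>e\<in>slopes. {lo e..<hi e})"
    using finite_slopes slope_intervals_disjoint by (intro card_UN_disjoint[symmetric]) auto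
  finally show ?thesis by (simp add: UN_slope_intervals)
qed

lemma lower_vertex_unique:
  assumes "v \<in> lower_vertices" "q \<in> S" "deg q = deg v" "ht q \<le> ht v"
  shows "q = v"
proof (rule ccontr)
  assume "q \<noteq> v"
  then obtain l where "weight l v < weight l q" using assms(1,2) unfolding lower_vertices_def by blast
  then show False using assms(3,4) by (simp add: weight_def)
qed

lemma inj_on_deg_lower_vertices: "inj_on deg lower_vertices"
proof (rule inj_onI)
  fix v w assume vw: "v \<in> lower_vertices" "w \<in> lower_vertices" "deg v = deg w"
  then have "v \<in> S" "w \<in> S" by (auto simp: lower_vertices_def)
  then show "v = w" using vw lower_vertex_unique[of v w] lower_vertex_unique[of w v] linear by metis
qed

text \<open>A point above the interior of an edge does not minimise any weight strictly, as weights are affine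
  along the edge.\<close>

lemma lower_vertex_right_end:
  assumes v: "v \<in> lower_vertices" and "e \<in> slopes" "lo e < deg v" "deg v \<le> hi e"
  shows "hi e = deg v"
proof (rule ccontr)
  assume "hi e \<noteq> deg v"
  obtain p q where pq: "p \<in> face e" "deg p = lo e" "q \<in> face e" "deg q = hi e" by (rule face_endpoints)
  have "v \<in> S" and "p \<noteq> v" "q \<noteq> v" using v pq assms(3) \<open>hi e \<noteq> deg v\<close> by (auto simp: lower_vertices_def)
  then obtain l where l: "weight l v < weight l p" "weight l v < weight l q"
    using v pq face_subset[of e] unfolding lower_vertices_def by blast
  have e: "weight e p \<le> weight e v" "weight e q \<le> weight e v" using pq \<open>v \<in> S\<close> by (auto simp: face_def)
  have "(l - e) * (real (deg v) - real (deg p)) < 0" "(l - e) * (real (deg v) - real (deg q)) < 0"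
    using l e by (simp_all add: weight_def algebra_simps)
  then show False using assms(3,4) pq \<open>hi e \<noteq> deg v\<close> by (auto simp: mult_less_0_iff)
qed

lemma card_lower_vertices: "card lower_vertices \<le> card slopes + 1"
proof -
  have "deg ` lower_vertices \<subseteq> insert (Min (deg ` S)) (hi ` slopes)"
  proof
    fix i assume "i \<in> deg ` lower_vertices"
    then obtain v where v: "v \<in> lower_vertices" "v \<in> S" "i = deg v" by (auto simp: lower_vertices_def)
    show "i \<in> insert (Min (deg ` S)) (hi ` slopes)"
    proof (cases "i = Min (deg ` S)")
      case False
      then have "i - 1 \<in> (\<Union>e\<in>slopes. {lo e..<hi e})"
        using deg_bounds[OF v(2)] by (auto simp: UN_slope_intervals v(3))
      then obtain e where "e \<in> slopes" "lo e \<le> i - 1" "i - 1 < hi e" by auto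
      moreover have "i > 0" using False deg_bounds[OF v(2)] v(3) by linarith
      ultimately have "e \<in> slopes" "hi e = i" using lower_vertex_right_end[OF v(1), of e] v(3) by auto
      then show ?thesis by auto
    qed simp
  qed
  then have "card (deg ` lower_vertices) \<le> card (insert (Min (deg ` S)) (hi ` slopes))"
    using finite_slopes by (intro card_mono) auto
  also have "\<dots> \<le> card (hi ` slopes) + 1" using finite_slopes by (simp add: card_insert_if)
  also have "\<dots> \<le> card slopes + 1" using card_image_le[OF finite_slopes] by simp
  finally show ?thesis by (simp add: card_image inj_on_deg_lower_vertices)
qed

end

section \<open>Degeneration to the edge polynomials\<close>

lemma tendsto_exp_mult_at_bot:
  assumes "0 \<le> (c :: real)"
  shows "((\<lambda>\<rho>. exp (\<rho> * c)) \<longlongrightarrow> of_bool (c = 0)) at_bot"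
proof (cases "c = 0")
  case False
  then have "filterlim (\<lambda>\<rho>. \<rho> * c) at_bot at_bot"
    using assms filterlim_tendsto_pos_mult_at_bot[OF tendsto_const, of c "\<lambda>\<rho>. \<rho>" at_bot]
    by (simp add: mult.commute filterlim_ident)
  from filterlim_compose[OF exp_at_bot this] show ?thesis using False by simp
qed simp

definition annulus :: "real \<Rightarrow> complex set" where
  "annulus \<delta> = {z. \<delta> < cmod z \<and> cmod z < 1 / \<delta>}"

lemma open_annulus: "open (annulus \<delta>)"
  unfolding annulus_def by (intro open_Collect_conj open_Collect_less continuous_intros)

lemma finite_subset_annulus:
  assumes "finite T" "0 \<notin> T"
  obtains \<delta> where "\<delta> > 0" "T \<subseteq> annulus \<delta>"
proof -
  have "\<forall>\<^sub>F \<delta> in at_right 0. \<forall>t\<in>T. \<delta> < cmod t \<and> cmod t < 1 / \<delta>"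
  proof (intro eventually_ball_finite assms(1) ballI)
    fix t assume "t \<in> T"
    then have "0 < cmod t" using assms(2) by auto
    then have "\<forall>\<^sub>F \<delta> in at_right 0. 0 < \<delta> \<and> \<delta> < cmod t \<and> \<delta> < 1 / cmod t"
      by (intro eventually_conj eventually_at_right_less order_tendstoD(2)[OF tendsto_ident_at]) auto
    then show "\<forall>\<^sub>F \<delta> in at_right 0. \<delta> < cmod t \<and> cmod t < 1 / \<delta>"
      by eventually_elim (use \<open>0 < cmod t\<close> in \<open>simp add: field_simps\<close>)
  qed
  with eventually_at_right_less have "\<forall>\<^sub>F \<delta> in at_right 0. 0 < \<delta> \<and> T \<subseteq> annulus \<delta>"
    by eventually_elim (auto simp: annulus_def)
  from eventually_happens'[OF trivial_limit_at_right_real this] show ?thesis using that by blast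
qed

lemma eventually_scaled_annuli_disjoint:
  assumes "e \<noteq> e'" "\<delta> > 0"
  shows "\<forall>\<^sub>F \<rho> in at_bot. (*) (of_real (exp (\<rho> * e))) ` annulus \<delta> \<inter>
    (*) (of_real (exp (\<rho> * e'))) ` annulus \<delta> = {}"
  using assms
proof (induction e e' rule: linorder_wlog)
  case (le e e')
  then have "((\<lambda>\<rho>. exp (\<rho> * (e' - e))) \<longlongrightarrow> 0) at_bot" using tendsto_exp_mult_at_bot[of "e' - e"] by simp
  then have "\<forall>\<^sub>F \<rho> in at_bot. exp (\<rho> * (e' - e)) < \<delta>\<^sup>2" using le by (intro order_tendstoD(2)) auto
  then show ?case
  proof eventually_elim
    case (elim \<rho>)
    have False if z: "z \<in> annulus \<delta>" "z' \<in> annulus \<delta>"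
      and eq: "of_real (exp (\<rho> * e)) * z = of_real (exp (\<rho> * e')) * z'" for z z'
    proof -
      have "exp (\<rho> * e) * cmod z = exp (\<rho> * e') * cmod z'" using arg_cong[OF eq, of cmod] by (simp add: norm_mult)
      also have "exp (\<rho> * e') = exp (\<rho> * e) * exp (\<rho> * (e' - e))" by (simp add: algebra_simps flip: exp_add)
      finally have "cmod z = exp (\<rho> * (e' - e)) * cmod z'" by simp
      also have "\<dots> < \<delta>\<^sup>2 * (1 / \<delta>)" using elim z(2) le(3) by (intro mult_strict_mono) (auto simp: annulus_def)
      also have "\<dots> = \<delta>" by (simp add: power2_eq_square)
      finally show False using z(1) by (simp add: annulus_def)
    qed
    then show ?case by blast
  qed
qed (simp_all add: Int_commute)

lemma eventually_scaled_annuli_disjoint_family: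
  assumes "finite E" "\<delta> > 0"
  shows "\<forall>\<^sub>F \<rho> in at_bot. disjoint_family_on (\<lambda>e. (*) (of_real (exp (\<rho> * e))) ` annulus \<delta>) E"
  unfolding disjoint_family_on_def
proof (intro eventually_ball_finite assms(1) ballI)
  fix e e'
  show "\<forall>\<^sub>F \<rho> in at_bot. e \<noteq> e' \<longrightarrow>
      (*) (of_real (exp (\<rho> * e))) ` annulus \<delta> \<inter> (*) (of_real (exp (\<rho> * e'))) ` annulus \<delta> = {}"
    using eventually_scaled_annuli_disjoint[OF _ assms(2), of e e'] by (cases "e = e'") simp_all
qed

context planar_points
begin

definition specialization :: "('a \<Rightarrow> complex) \<Rightarrow> complex \<Rightarrow> complex poly" where
  "specialization F w = (\<Sum>p\<in>S. monom (F p * exp (of_int (ht p) * w)) (deg p))"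

definition edge_poly :: "('a \<Rightarrow> complex) \<Rightarrow> real \<Rightarrow> complex poly" where
  "edge_poly F e = (\<Sum>p\<in>face e. monom (F p) (deg p))"

definition rescaled :: "('a \<Rightarrow> complex) \<Rightarrow> real \<Rightarrow> real \<Rightarrow> complex poly" where
  "rescaled F e \<rho> = (\<Sum>p\<in>S. monom (F p * of_real (exp (\<rho> * (weight e p - Min (weight e ` S))))) (deg p))"

lemma coeff_edge_poly_face:
  assumes "p \<in> face e"
  shows "coeff (edge_poly F e) (deg p) = F p"
proof -
  have "coeff (edge_poly F e) (deg p) = (\<Sum>q\<in>face e. if deg q = deg p then F q else 0)"
    by (simp add: edge_poly_def coeff_sum)
  also have "\<dots> = (\<Sum>q\<in>face e. if q = p then F q else 0)"
    using assms inj_on_deg_face[of e] by (intro sum.cong refl) (auto dest: inj_onD)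
  also have "\<dots> = F p" using assms finite_face by simp
  finally show ?thesis .
qed

lemma nz_root_count_edge_poly:
  assumes "\<And>p. p \<in> S \<Longrightarrow> F p \<noteq> 0"
  shows "edge_poly F e \<noteq> 0" and "nz_root_count (edge_poly F e) = hi e - lo e"
proof -
  obtain p q where pq: "p \<in> face e" "deg p = lo e" "q \<in> face e" "deg q = hi e" by (rule face_endpoints)
  have nz: "coeff (edge_poly F e) (lo e) \<noteq> 0" "coeff (edge_poly F e) (hi e) \<noteq> 0"
    using coeff_edge_poly_face[OF pq(1), of F] coeff_edge_poly_face[OF pq(3), of F] pq assms face_subset
    by auto
  then show "edge_poly F e \<noteq> 0" by auto
  have "root_count (- {0}) (edge_poly F e) = hi e - lo e"
  proof (rule root_count_nonzero_eq[OF nz])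
    fix i assume "coeff (edge_poly F e) i \<noteq> 0"
    then have "i \<in> deg ` face e" unfolding edge_poly_def by (rule coeff_sum_monom_nonzero)
    then show "lo e \<le> i \<and> i \<le> hi e" using deg_face_bounds by blast
  qed
  then show "nz_root_count (edge_poly F e) = hi e - lo e" by (simp add: nz_root_count_eq_root_count)
qed

lemma nz_root_count_specialization_le:
  assumes "specialization F w \<noteq> 0"
  shows "nz_root_count (specialization F w) \<le> Max (deg ` S) - Min (deg ` S)"
  unfolding nz_root_count_eq_root_count
proof (rule root_count_nonzero_le[OF assms])
  fix i assume "coeff (specialization F w) i \<noteq> 0"
  then have "i \<in> deg ` S" unfolding specialization_def by (rule coeff_sum_monom_nonzero)
  then show "Min (deg ` S) \<le> i \<and> i \<le> Max (deg ` S)" using finite_points by simp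
qed

lemma pcompose_specialization:
  "pcompose (specialization F (of_real \<rho>)) [:0, of_real (exp (\<rho> * e)):] =
    smult (of_real (exp (\<rho> * Min (weight e ` S)))) (rescaled F e \<rho>)"
proof (rule poly_eqI)
  fix i
  have "exp (\<rho> * e) ^ deg p * exp (of_int (ht p) * \<rho>) =
      exp (\<rho> * Min (weight e ` S)) * exp (\<rho> * (weight e p - Min (weight e ` S)))" for p
    by (simp add: weight_def algebra_simps flip: exp_add exp_of_nat_mult)
  then have "of_real (exp (\<rho> * e)) ^ deg p * exp (of_int (ht p) * of_real \<rho> :: complex) =
      of_real (exp (\<rho> * Min (weight e ` S))) * of_real (exp (\<rho> * (weight e p - Min (weight e ` S))))" for p
    by (metis exp_of_real of_real_mult of_real_of_int_eq of_real_power)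
  then show "coeff (pcompose (specialization F (of_real \<rho>)) [:0, of_real (exp (\<rho> * e)):]) i =
      coeff (smult (of_real (exp (\<rho> * Min (weight e ` S)))) (rescaled F e \<rho>)) i"
    by (auto simp: specialization_def rescaled_def coeff_sum coeff_pcompose_linear sum_distrib_left mult_ac
        intro!: sum.cong)
qed

lemma tendsto_coeff_rescaled:
  "((\<lambda>\<rho>. coeff (rescaled F e \<rho>) i) \<longlongrightarrow> coeff (edge_poly F e) i) at_bot"
proof -
  define m where "m = Min (weight e ` S)"
  have lim: "((\<lambda>\<rho>. complex_of_real (exp (\<rho> * (weight e p - m)))) \<longlongrightarrow> of_bool (p \<in> face e)) at_bot"
    if "p \<in> S" for p
  proof -
    have "0 \<le> weight e p - m" using that finite_points by (simp add: m_def)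
    moreover have "weight e p - m = 0 \<longleftrightarrow> p \<in> face e" using that by (auto simp: mem_face_iff m_def)
    ultimately show ?thesis
      using tendsto_of_real[OF tendsto_exp_mult_at_bot[of "weight e p - m"], where 'a = complex]
      by (cases "p \<in> face e") simp_all
  qed
  have "((\<lambda>\<rho>. \<Sum>p\<in>S. of_bool (deg p = i) * (F p * of_real (exp (\<rho> * (weight e p - m))))) \<longlongrightarrow>
      (\<Sum>p\<in>S. of_bool (deg p = i) * (F p * of_bool (p \<in> face e)))) at_bot"
    by (intro tendsto_intros lim)
  also have "(\<Sum>p\<in>S. of_bool (deg p = i) * (F p * of_bool (p \<in> face e))) = coeff (edge_poly F e) i"
    unfolding edge_poly_def coeff_sum using finite_points face_subset[of e]
    by (intro sum.mono_neutral_cong_right) auto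
  also have "(\<lambda>\<rho>. \<Sum>p\<in>S. of_bool (deg p = i) * (F p * of_real (exp (\<rho> * (weight e p - m))))) =
      (\<lambda>\<rho>. coeff (rescaled F e \<rho>) i)"
    unfolding rescaled_def coeff_sum m_def by (intro ext sum.cong) auto
  finally show ?thesis .
qed

lemma degree_rescaled_le: "degree (rescaled F e \<rho>) \<le> Max (deg ` S)"
  unfolding rescaled_def
proof (rule degree_sum_le)
  show "degree (monom (c p) (deg p)) \<le> Max (deg ` S)" if "p \<in> S" for p and c :: "'a \<Rightarrow> complex"
    using that finite_points degree_monom_le[of "c p" "deg p"] by (auto intro: order_trans)
qed (rule finite_points)

lemma eventually_root_count_cluster_ge:
  assumes "\<And>p. p \<in> S \<Longrightarrow> F p \<noteq> 0" "open U"
  shows "\<forall>\<^sub>F \<rho> in at_bot. specialization F (of_real \<rho>) \<noteq> 0 \<and> root_count U (edge_poly F e) \<le>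
    root_count ((*) (of_real (exp (\<rho> * e))) ` U) (specialization F (of_real \<rho>))"
proof -
  have "\<forall>\<^sub>F \<rho> in at_bot. rescaled F e \<rho> \<noteq> 0 \<and> root_count U (edge_poly F e) \<le> root_count U (rescaled F e \<rho>)"
    using tendsto_coeff_rescaled degree_rescaled_le nz_root_count_edge_poly(1)[of F, OF assms(1)] assms(2)
    by (rule eventually_root_count_ge)
  then show ?thesis
  proof eventually_elim
    case (elim \<rho>)
    let ?c = "of_real (exp (\<rho> * e)) :: complex"
    have "specialization F (of_real \<rho>) \<noteq> 0" using elim pcompose_specialization[of F \<rho> e] by auto
    moreover have "root_count U (rescaled F e \<rho>) = root_count ((*) ?c ` U) (specialization F (of_real \<rho>))"
      using root_count_pcompose_scale[OF \<open>specialization F (of_real \<rho>) \<noteq> 0\<close>, of ?c U]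
      by (simp add: pcompose_specialization root_count_smult)
    ultimately show ?case using elim by simp
  qed
qed

lemma eventually_sum_root_count_edge_poly_le:
  assumes "\<And>p. p \<in> S \<Longrightarrow> F p \<noteq> 0" "open U" "0 \<notin> U"
    and scale: "\<And>r z. r > 0 \<Longrightarrow> z \<in> U \<Longrightarrow> of_real r * z \<in> U"
  shows "\<forall>\<^sub>F \<rho> in at_bot. (\<Sum>e\<in>slopes. root_count U (edge_poly F e)) \<le> root_count U (specialization F (of_real \<rho>))"
proof -
  define roots where "roots e = {z\<in>U. poly (edge_poly F e) z = 0}" for e
  have "finite (\<Union>e\<in>slopes. roots e)"
    using finite_slopes poly_roots_finite[OF nz_root_count_edge_poly(1)[of F, OF assms(1)]] by (auto simp: roots_def)
  moreover have "0 \<notin> (\<Union>e\<in>slopes. roots e)" using assms(3) by (simp add: roots_def)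
  ultimately obtain \<delta> where \<delta>: "\<delta> > 0" "(\<Union>e\<in>slopes. roots e) \<subseteq> annulus \<delta>" by (rule finite_subset_annulus)
  define cluster where "cluster \<rho> e = (*) (of_real (exp (\<rho> * e))) ` (U \<inter> annulus \<delta>)" for \<rho> e
  have "\<forall>\<^sub>F \<rho> in at_bot. \<forall>e\<in>slopes. specialization F (of_real \<rho>) \<noteq> 0 \<and>
      root_count (U \<inter> annulus \<delta>) (edge_poly F e) \<le> root_count (cluster \<rho> e) (specialization F (of_real \<rho>))"
    unfolding cluster_def
    by (intro eventually_ball_finite finite_slopes ballI eventually_root_count_cluster_ge assms(1)
        open_Int assms(2) open_annulus)
  moreover have "\<forall>\<^sub>F \<rho> in at_bot. disjoint_family_on (\<lambda>e. (*) (of_real (exp (\<rho> * e))) ` annulus \<delta>) slopes"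
    using finite_slopes \<delta>(1) by (rule eventually_scaled_annuli_disjoint_family)
  ultimately show ?thesis
  proof eventually_elim
    case (elim \<rho>)
    let ?G = "specialization F (of_real \<rho>)"
    show ?case
    proof (cases "slopes = {}")
      case False
      then have "?G \<noteq> 0" using elim(1) by blast
      have disjoint: "disjoint_family_on (cluster \<rho>) slopes"
        using elim(2) by (rule disjoint_family_on_bisimulation) (auto simp: cluster_def)
      have "root_count U (edge_poly F e) = root_count (U \<inter> annulus \<delta>) (edge_poly F e)" if "e \<in> slopes" for e
        using \<delta>(2) that by (intro root_count_cong) (auto simp: roots_def)
      then have "(\<Sum>e\<in>slopes. root_count U (edge_poly F e)) \<le> (\<Sum>e\<in>slopes. root_count (cluster \<rho> e) ?G)"
        using elim(1) by (intro sum_mono) auto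
      also have "\<dots> = root_count (\<Union>e\<in>slopes. cluster \<rho> e) ?G"
        using \<open>?G \<noteq> 0\<close> finite_slopes disjoint by (intro root_count_UN_disjoint[symmetric])
      also have "\<dots> \<le> root_count U ?G"
        using \<open>?G \<noteq> 0\<close> scale by (intro root_count_mono) (auto simp: cluster_def)
      finally show ?thesis .
    qed simp
  qed
qed

text \<open>The lower bounds for \<open>U\<close> and for \<open>V\<close> add up to the number of all nonzero roots, so all are sharp.\<close>

lemma eventually_root_count_specialization_eq:
  assumes "\<And>p. p \<in> S \<Longrightarrow> F p \<noteq> 0" "open U" "open V" "U \<inter> V = {}" "0 \<notin> U" "0 \<notin> V"
    and scale: "\<And>r z. r > 0 \<Longrightarrow> z \<in> U \<Longrightarrow> of_real r * z \<in> U" "\<And>r z. r > 0 \<Longrightarrow> z \<in> V \<Longrightarrow> of_real r * z \<in> V"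
    and roots: "\<And>e. e \<in> slopes \<Longrightarrow> nonzero_roots (edge_poly F e) \<subseteq> U \<union> V"
  shows "\<forall>\<^sub>F \<rho> in at_bot. specialization F (of_real \<rho>) \<noteq> 0 \<and>
    root_count U (specialization F (of_real \<rho>)) = (\<Sum>e\<in>slopes. root_count U (edge_poly F e)) \<and>
    root_count U (specialization F (of_real \<rho>)) + root_count V (specialization F (of_real \<rho>)) =
      nz_root_count (specialization F (of_real \<rho>)) \<and>
    nz_root_count (specialization F (of_real \<rho>)) = (\<Sum>e\<in>slopes. nz_root_count (edge_poly F e))"
proof -
  have edge: "nz_root_count (edge_poly F e) = root_count U (edge_poly F e) + root_count V (edge_poly F e)"
    if "e \<in> slopes" for e
    using roots[OF that] assms(1,4-6) nz_root_count_edge_poly(1) by (intro nz_root_count_eq_add) auto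
  have "\<forall>\<^sub>F \<rho> in at_bot. specialization F (of_real \<rho>) \<noteq> 0"
    by (rule eventually_mono[OF eventually_root_count_cluster_ge[OF assms(1) open_empty, where e = 0]]) auto
  moreover have "\<forall>\<^sub>F \<rho> in at_bot.
      (\<Sum>e\<in>slopes. root_count U (edge_poly F e)) \<le> root_count U (specialization F (of_real \<rho>))"
    using assms(1,2,5) scale(1) by (rule eventually_sum_root_count_edge_poly_le)
  moreover have "\<forall>\<^sub>F \<rho> in at_bot.
      (\<Sum>e\<in>slopes. root_count V (edge_poly F e)) \<le> root_count V (specialization F (of_real \<rho>))"
    using assms(1,3,6) scale(2) by (rule eventually_sum_root_count_edge_poly_le)
  ultimately show ?thesis
  proof eventually_elim
    case (elim \<rho>)
    let ?G = "specialization F (of_real \<rho>)"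
    have "root_count U ?G + root_count V ?G = root_count (U \<union> V) ?G"
      using elim(1) assms(4) by (intro root_count_Un_disjoint[symmetric])
    also have "\<dots> \<le> nz_root_count ?G"
      unfolding nz_root_count_eq_root_count using elim(1) assms(5,6) by (intro root_count_mono) auto
    finally have "root_count U ?G + root_count V ?G \<le> nz_root_count ?G" .
    moreover have "nz_root_count ?G \<le> (\<Sum>e\<in>slopes. nz_root_count (edge_poly F e))"
      using nz_root_count_specialization_le[OF elim(1)] nz_root_count_edge_poly(2)[of F] assms(1)
      by (simp add: sum_slope_widths)
    moreover have "(\<Sum>e\<in>slopes. nz_root_count (edge_poly F e)) =
        (\<Sum>e\<in>slopes. root_count U (edge_poly F e)) + (\<Sum>e\<in>slopes. root_count V (edge_poly F e))"
      using edge by (simp add: sum.distrib)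
    ultimately show ?case using elim by linarith
  qed
qed

lemma eventually_N_arg_specialization_eq:
  assumes "\<And>p. p \<in> S \<Longrightarrow> F p \<noteq> 0" "0 \<le> \<alpha>" "\<alpha> \<le> \<beta>" "\<beta> < 2 * pi"
    and roots: "\<And>e z. e \<in> slopes \<Longrightarrow> z \<in> nonzero_roots (edge_poly F e) \<Longrightarrow> arg02pi z \<noteq> \<alpha> \<and> arg02pi z \<noteq> \<beta>"
  shows "\<forall>\<^sub>F \<rho> in at_bot. specialization F (of_real \<rho>) \<noteq> 0 \<and>
    N_arg \<alpha> \<beta> (specialization F (of_real \<rho>)) = (\<Sum>e\<in>slopes. N_arg \<alpha> \<beta> (edge_poly F e)) \<and>
    nz_root_count (specialization F (of_real \<rho>)) = (\<Sum>e\<in>slopes. nz_root_count (edge_poly F e))"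
proof -
  define U where "U = sector \<alpha> \<beta>"
  define V where "V = sector \<beta> (\<alpha> + 2 * pi)"
  define A where "A = {z. z \<noteq> 0 \<and> \<alpha> \<le> arg02pi z \<and> arg02pi z \<le> \<beta>}"
  have U: "z \<in> U \<longleftrightarrow> z \<noteq> 0 \<and> \<alpha> < arg02pi z \<and> arg02pi z < \<beta>" for z
    unfolding U_def using assms(2,4) by (intro mem_sector_iff) auto
  have V: "z \<in> V \<longleftrightarrow> z \<noteq> 0 \<and> (arg02pi z < \<alpha> \<or> \<beta> < arg02pi z)" for z
    unfolding V_def using assms(2-4) by (rule mem_opposite_sector_iff)
  have N: "N_arg \<alpha> \<beta> p = root_count A p" for p by (simp add: N_arg_eq_root_count A_def)
  have edge: "N_arg \<alpha> \<beta> (edge_poly F e) = root_count U (edge_poly F e)" if "e \<in> slopes" for e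
    unfolding N using roots[OF that] by (intro root_count_cong) (force simp: A_def U nonzero_roots_def)
  have "\<forall>\<^sub>F \<rho> in at_bot. specialization F (of_real \<rho>) \<noteq> 0 \<and>
      root_count U (specialization F (of_real \<rho>)) = (\<Sum>e\<in>slopes. root_count U (edge_poly F e)) \<and>
      root_count U (specialization F (of_real \<rho>)) + root_count V (specialization F (of_real \<rho>)) =
        nz_root_count (specialization F (of_real \<rho>)) \<and>
      nz_root_count (specialization F (of_real \<rho>)) = (\<Sum>e\<in>slopes. nz_root_count (edge_poly F e))"
  proof (rule eventually_root_count_specialization_eq)
    show "open U" "open V" unfolding U_def V_def by (rule open_sector)+
    show "of_real r * z \<in> U" if "r > 0" "z \<in> U" for r z using that unfolding U_def by (intro sector_scale)
    show "of_real r * z \<in> V" if "r > 0" "z \<in> V" for r z using that unfolding V_def by (intro sector_scale)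
    show "nonzero_roots (edge_poly F e) \<subseteq> U \<union> V" if "e \<in> slopes" for e
      using roots[OF that] by (force simp: U V nonzero_roots_def)
  qed (use assms(1,3) in \<open>auto simp: U V\<close>)
  then show ?thesis
  proof eventually_elim
    case (elim \<rho>)
    let ?G = "specialization F (of_real \<rho>)"
    have "root_count A ?G + root_count V ?G = root_count (A \<union> V) ?G"
      using elim by (intro root_count_Un_disjoint[symmetric]) (auto simp: A_def V)
    also have "A \<union> V = - {0}" by (auto simp: A_def V)
    finally show ?case using elim edge by (simp add: N nz_root_count_eq_root_count)
  qed
qed

lemma eventually_sawtooth_sum_le_bias:
  assumes "\<And>p. p \<in> S \<Longrightarrow> F p \<noteq> 0" "0 \<le> \<alpha>" "\<alpha> \<le> \<beta>" "\<beta> < 2 * pi"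
    and "\<And>e z. e \<in> slopes \<Longrightarrow> z \<in> nonzero_roots (edge_poly F e) \<Longrightarrow> arg02pi z \<noteq> \<alpha> \<and> arg02pi z \<noteq> \<beta>"
  shows "\<forall>\<^sub>F \<rho> in at_bot. specialization F (of_real \<rho>) \<noteq> 0 \<and>
    \<bar>\<Sum>e\<in>slopes. sawtooth (edge_poly F e) \<alpha> - sawtooth (edge_poly F e) \<beta>\<bar> \<le> bias (specialization F (of_real \<rho>))"
  using eventually_N_arg_specialization_eq[of F \<alpha> \<beta>]
proof (rule eventually_mono)
  fix \<rho>
  let ?G = "specialization F (of_real \<rho>)"
  assume G: "?G \<noteq> 0 \<and> N_arg \<alpha> \<beta> ?G = (\<Sum>e\<in>slopes. N_arg \<alpha> \<beta> (edge_poly F e)) \<and>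
    nz_root_count ?G = (\<Sum>e\<in>slopes. nz_root_count (edge_poly F e))"
  have "(\<Sum>e\<in>slopes. sawtooth (edge_poly F e) \<alpha> - sawtooth (edge_poly F e) \<beta>) =
      (\<Sum>e\<in>slopes. real (N_arg \<alpha> \<beta> (edge_poly F e)) - real (nz_root_count (edge_poly F e)) * (\<beta> - \<alpha>) / (2 * pi))"
    using assms nz_root_count_edge_poly(1)[of F] by (intro sum.cong refl N_arg_minus_expected_eq[symmetric]) auto
  also have "\<dots> = real (N_arg \<alpha> \<beta> ?G) - real (nz_root_count ?G) * (\<beta> - \<alpha>) / (2 * pi)"
    using G by (simp add: sum_subtractf sum_distrib_right sum_divide_distrib)
  finally show "?G \<noteq> 0 \<and> \<bar>\<Sum>e\<in>slopes. sawtooth (edge_poly F e) \<alpha> - sawtooth (edge_poly F e) \<beta>\<bar> \<le> bias ?G"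
    using bias_ge[of ?G \<alpha> \<beta>] G assms(2-4) by simp
qed (use assms in auto)

definition twist :: "real \<Rightarrow> ('a \<Rightarrow> complex) \<Rightarrow> 'a \<Rightarrow> complex" where
  "twist \<theta> F p = F p * cis (\<theta> * of_int (ht p))"

lemma specialization_twist: "specialization (twist \<theta> F) w = specialization F (w + \<i> * of_real \<theta>)"
  by (simp add: specialization_def twist_def cis_conv_exp ring_distribs exp_add mult_ac)

lemma edge_poly_twist:
  "edge_poly (twist \<theta> F) e = smult (cis (\<theta> * Min (weight e ` S))) (pcompose (edge_poly F e) [:0, cis (- (\<theta> * e)):])"
proof (rule poly_eqI)
  fix i
  have "cis (\<theta> * of_int (ht p)) = cis (\<theta> * Min (weight e ` S)) * cis (- (\<theta> * e)) ^ deg p" if "p \<in> face e" for p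
  proof -
    have "\<theta> * of_int (ht p) = \<theta> * weight e p + real (deg p) * - (\<theta> * e)"
      by (simp add: weight_def algebra_simps)
    also have "weight e p = Min (weight e ` S)" using that by (simp add: mem_face_iff)
    finally show ?thesis by (simp only: Complex.DeMoivre cis_mult)
  qed
  then show "coeff (edge_poly (twist \<theta> F) e) i =
      coeff (smult (cis (\<theta> * Min (weight e ` S))) (pcompose (edge_poly F e) [:0, cis (- (\<theta> * e)):])) i"
    by (auto simp: edge_poly_def twist_def coeff_sum coeff_pcompose_linear sum_distrib_left intro!: sum.cong)
qed

lemma sawtooth_edge_poly_twist:
  assumes "\<And>p. p \<in> S \<Longrightarrow> F p \<noteq> 0"
  shows "sawtooth (edge_poly (twist \<theta> F) e) x = sawtooth (edge_poly F e) (x - \<theta> * e)"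
  using nz_root_count_edge_poly(1)[of F, OF assms]
  by (simp add: edge_poly_twist sawtooth_smult sawtooth_rotate)

lemma nonzero_roots_edge_poly_twist:
  "nonzero_roots (edge_poly (twist \<theta> F) e) = (*) (cis (\<theta> * e)) ` nonzero_roots (edge_poly F e)"
proof -
  have "nonzero_roots (smult c p) = nonzero_roots p" if "c \<noteq> 0" for c p
    using that by (simp add: nonzero_roots_def)
  then show ?thesis by (simp add: edge_poly_twist nonzero_roots_pcompose_scale)
qed

lemma arg02pi_edge_root_twist:
  assumes z: "z \<in> nonzero_roots (edge_poly (twist \<theta> F) e)"
    and generic: "\<And>t. t \<in> nonzero_roots (edge_poly F e) \<Longrightarrow> (x - \<theta> * e - Arg t) / (2 * pi) \<notin> \<int>"
  shows "arg02pi z \<noteq> x"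
proof
  assume x: "arg02pi z = x"
  obtain t where t: "t \<in> nonzero_roots (edge_poly F e)" "z = cis (\<theta> * e) * t"
    using z by (auto simp: nonzero_roots_edge_poly_twist)
  then have "frac ((x - \<theta> * e - Arg t) / (2 * pi)) = frac ((x - Arg z) / (2 * pi))"
    by (simp add: frac_diff_Arg_cis_mult nonzero_roots_def)
  also have "\<dots> = 0"
    using x arg02pi_nonneg[of z] arg02pi_less[of z] by (simp add: frac_diff_Arg_eq)
  finally show False using generic[OF t(1)] by simp
qed

lemma exists_large_twisted_sawtooth_sum:
  assumes "\<And>p. p \<in> S \<Longrightarrow> F p \<noteq> 0"
  obtains \<alpha> \<beta> \<theta> where "0 \<le> \<alpha>" "\<alpha> \<le> \<beta>" "\<beta> < 2 * pi"
    "\<And>e z. e \<in> slopes \<Longrightarrow> z \<in> nonzero_roots (edge_poly (twist \<theta> F) e) \<Longrightarrow> arg02pi z \<noteq> \<alpha> \<and> arg02pi z \<noteq> \<beta>"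
    "sqrt (real (card slopes)) / 6 \<le>
      \<bar>\<Sum>e\<in>slopes. sawtooth (edge_poly (twist \<theta> F) e) \<alpha> - sawtooth (edge_poly (twist \<theta> F) e) \<beta>\<bar>"
proof -
  define Q :: real where "Q = fact (Max (deg ` S))"
  have "Q > 0" by (simp add: Q_def)
  define v where "v e = - \<lfloor>Q * e\<rfloor>" for e
  have v: "of_int (v e) = - Q * e" if "e \<in> slopes" for e
    using fact_mult_slope_in_Ints[OF that] by (simp add: v_def Q_def)
  have inj: "inj_on v slopes"
  proof (rule inj_onI)
    fix e e' assume "e \<in> slopes" "e' \<in> slopes" "v e = v e'"
    then have "- Q * e = - Q * e'" by (metis v)
    then show "e = e'" using \<open>Q > 0\<close> by simp
  qed
  have pos: "0 < nz_root_count (edge_poly F e)" if "e \<in> slopes" for e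
    using nz_root_count_edge_poly(2)[of F, OF assms] that by (simp add: slopes_def)
  obtain \<alpha> \<beta> \<theta> where \<alpha>\<beta>: "0 \<le> \<alpha>" "\<alpha> \<le> \<beta>" "\<beta> < 2 * pi"
    and generic: "\<And>e z. e \<in> slopes \<Longrightarrow> z \<in> nonzero_roots (edge_poly F e) \<Longrightarrow>
        (\<alpha> + of_int (v e) * \<theta> - Arg z) / (2 * pi) \<notin> \<int>"
      "\<And>e z. e \<in> slopes \<Longrightarrow> z \<in> nonzero_roots (edge_poly F e) \<Longrightarrow>
        (\<beta> + of_int (v e) * \<theta> - Arg z) / (2 * pi) \<notin> \<int>"
    and large: "sqrt (real (card slopes)) / 6 \<le> \<bar>\<Sum>e\<in>slopes. sawtooth (edge_poly F e) (\<alpha> + of_int (v e) * \<theta>) -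
        sawtooth (edge_poly F e) (\<beta> + of_int (v e) * \<theta>)\<bar>"
    by (rule exists_large_sawtooth_sum[where P = "edge_poly F", OF finite_slopes inj pos]) (assumption, rule that)
  have shift: "x + of_int (v e) * \<theta> = x - Q * \<theta> * e" if "e \<in> slopes" for e x using v[OF that] by simp
  show ?thesis
  proof (rule that[of \<alpha> \<beta> "Q * \<theta>"])
    show "arg02pi z \<noteq> \<alpha> \<and> arg02pi z \<noteq> \<beta>"
      if "e \<in> slopes" "z \<in> nonzero_roots (edge_poly (twist (Q * \<theta>) F) e)" for e z
      using arg02pi_edge_root_twist[OF that(2)] generic[OF that(1)] by (simp add: shift[OF that(1)])
    have "(\<Sum>e\<in>slopes. sawtooth (edge_poly (twist (Q * \<theta>) F) e) \<alpha> - sawtooth (edge_poly (twist (Q * \<theta>) F) e) \<beta>) =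
        (\<Sum>e\<in>slopes. sawtooth (edge_poly F e) (\<alpha> + of_int (v e) * \<theta>) -
          sawtooth (edge_poly F e) (\<beta> + of_int (v e) * \<theta>))"
      using shift assms by (intro sum.cong) (simp_all add: sawtooth_edge_poly_twist)
    then show "sqrt (real (card slopes)) / 6 \<le> \<bar>\<Sum>e\<in>slopes.
        sawtooth (edge_poly (twist (Q * \<theta>) F) e) \<alpha> - sawtooth (edge_poly (twist (Q * \<theta>) F) e) \<beta>\<bar>"
      using large by simp
  qed (use \<alpha>\<beta> in auto)
qed

lemma exists_large_bias_specialization:
  assumes "\<And>p. p \<in> S \<Longrightarrow> F p \<noteq> 0"
  shows "\<exists>w. specialization F w \<noteq> 0 \<and> sqrt (real (card slopes)) / 6 \<le> bias (specialization F w)"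
proof -
  obtain \<alpha> \<beta> \<theta> where \<alpha>\<beta>: "0 \<le> \<alpha>" "\<alpha> \<le> \<beta>" "\<beta> < 2 * pi"
    and generic: "\<And>e z. e \<in> slopes \<Longrightarrow> z \<in> nonzero_roots (edge_poly (twist \<theta> F) e) \<Longrightarrow>
        arg02pi z \<noteq> \<alpha> \<and> arg02pi z \<noteq> \<beta>"
    and large: "sqrt (real (card slopes)) / 6 \<le>
        \<bar>\<Sum>e\<in>slopes. sawtooth (edge_poly (twist \<theta> F) e) \<alpha> - sawtooth (edge_poly (twist \<theta> F) e) \<beta>\<bar>"
    by (rule exists_large_twisted_sawtooth_sum[OF assms]) (assumption, rule that)
  have "\<forall>\<^sub>F \<rho> in at_bot. specialization (twist \<theta> F) (of_real \<rho>) \<noteq> 0 \<and>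
      \<bar>\<Sum>e\<in>slopes. sawtooth (edge_poly (twist \<theta> F) e) \<alpha> - sawtooth (edge_poly (twist \<theta> F) e) \<beta>\<bar> \<le>
      bias (specialization (twist \<theta> F) (of_real \<rho>))"
    using assms by (intro eventually_sawtooth_sum_le_bias \<alpha>\<beta> generic) (simp_all add: twist_def)
  from eventually_happens'[OF trivial_limit_at_bot_linorder this] show ?thesis
    using large by (auto simp: specialization_twist)
qed

end

section \<open>Vertices of the Newton polygon\<close>

lemma extreme_point_strict_maximizer:
  fixes X :: "'a :: euclidean_space set"
  assumes "finite X" "v extreme_point_of (convex hull X)"
  shows "v \<in> X" and "\<exists>c. \<forall>x\<in>X - {v}. c \<bullet> x < c \<bullet> v"
proof -
  show "v \<in> X" using assms(2) by (rule extreme_point_of_convex_hull)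
  have "{v} face_of convex hull X" using assms(2) by (simp add: face_of_singleton)
  then have "{v} exposed_face_of convex hull X"
    using assms(1) exposed_face_of_polyhedron polyhedron_convex_hull by blast
  then obtain c d where cd: "convex hull X \<subseteq> {x. c \<bullet> x \<le> d}" "{v} = convex hull X \<inter> {x. c \<bullet> x = d}"
    unfolding exposed_face_of_def by blast
  have "c \<bullet> x < c \<bullet> v" if "x \<in> X - {v}" for x
  proof -
    have "x \<in> convex hull X" using that by (simp add: hull_inc)
    then have "c \<bullet> x \<le> d" "c \<bullet> x \<noteq> d" using cd that by blast+
    moreover have "c \<bullet> v = d" using cd(2) by blast
    ultimately show ?thesis by simp
  qed
  then show "\<exists>c. \<forall>x\<in>X - {v}. c \<bullet> x < c \<bullet> v" by blast
qed

lemma finite_strict_maximizer_perturb: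
  fixes f g :: "'a \<Rightarrow> real"
  assumes "finite Q" "\<And>q. q \<in> Q \<Longrightarrow> \<alpha> * f q + \<beta> * g q < \<alpha> * f p + \<beta> * g p"
  shows "\<exists>\<beta>'. \<beta>' \<noteq> 0 \<and> (\<forall>q\<in>Q. \<alpha> * f q + \<beta>' * g q < \<alpha> * f p + \<beta>' * g p)"
proof -
  have "\<forall>\<^sub>F \<beta>' in at \<beta>. \<forall>q\<in>Q. \<alpha> * f q + \<beta>' * g q - (\<alpha> * f p + \<beta>' * g p) < 0"
  proof (intro eventually_ball_finite assms(1) ballI order_tendstoD(2))
    fix q assume "q \<in> Q"
    show "((\<lambda>\<beta>'. \<alpha> * f q + \<beta>' * g q - (\<alpha> * f p + \<beta>' * g p)) \<longlongrightarrow>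
        \<alpha> * f q + \<beta> * g q - (\<alpha> * f p + \<beta> * g p)) (at \<beta>)"
      by (intro tendsto_intros)
    show "\<alpha> * f q + \<beta> * g q - (\<alpha> * f p + \<beta> * g p) < 0" using assms(2)[OF \<open>q \<in> Q\<close>] by simp
  qed
  moreover have "\<forall>\<^sub>F \<beta>' in at \<beta>. \<beta>' \<noteq> 0"
    by (rule eventually_neq_at_within)
  ultimately have "\<forall>\<^sub>F \<beta>' in at \<beta>. \<beta>' \<noteq> 0 \<and> (\<forall>q\<in>Q. \<alpha> * f q + \<beta>' * g q < \<alpha> * f p + \<beta>' * g p)"
    by eventually_elim simp
  then show ?thesis by (rule eventually_happens'[rotated]) simp
qed

text \<open>The vertices of the lower boundary for \<open>\<sigma> = 1\<close> and of the upper boundary for \<open>\<sigma> = - 1\<close>.\<close>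

definition side_vertices :: "int \<Rightarrow> (nat \<times> nat) set \<Rightarrow> (nat \<times> nat) set" where
  "side_vertices \<sigma> S = planar_points.lower_vertices S fst (\<lambda>p. \<sigma> * int (snd p))"

lemma planar_points_scaled:
  assumes "finite S" "S \<noteq> {}" "\<sigma> \<noteq> 0"
  shows "planar_points S fst (\<lambda>p :: nat \<times> nat. \<sigma> * int (snd p))"
  using assms by unfold_locales (auto simp: inj_on_def)

lemma exists_large_bias_spec_y:
  assumes "is_bipoly F" "supp2 F \<noteq> {}" "\<sigma> \<noteq> 0"
  shows "\<exists>a. a \<noteq> 0 \<and> spec_y F a \<noteq> 0 \<and>
    sqrt (real (card (side_vertices \<sigma> (supp2 F)) - 1)) / 6 \<le> bias (spec_y F a)"
proof -
  interpret planar_points "supp2 F" fst "\<lambda>p. \<sigma> * int (snd p)"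
    using assms by (intro planar_points_scaled) (auto simp: is_bipoly_def)
  obtain w where w: "specialization F w \<noteq> 0" "sqrt (real (card slopes)) / 6 \<le> bias (specialization F w)"
    using exists_large_bias_specialization[of F] by (auto simp: supp2_def)
  have "exp (of_int (\<sigma> * int j) * w) = exp (of_int \<sigma> * w) ^ j" for j
    by (simp add: exp_of_nat_mult[symmetric] mult_ac)
  then have spec: "specialization F w = spec_y F (exp (of_int \<sigma> * w))"
    by (simp add: specialization_def spec_y_def)
  have "card (side_vertices \<sigma> (supp2 F)) - 1 \<le> card slopes"
    using card_lower_vertices by (simp add: side_vertices_def)
  then have "sqrt (real (card (side_vertices \<sigma> (supp2 F)) - 1)) / 6 \<le> sqrt (real (card slopes)) / 6"
    by simp
  also note w(2)
  finally show ?thesis using w(1) exp_not_eq_zero unfolding spec by blast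
qed

lemma mem_side_verticesI:
  assumes "finite S" "p \<in> S" "\<beta> \<noteq> 0" and less: "\<forall>q\<in>S - {p}.
    \<alpha> * real (fst q) + \<beta> * real (snd q) < \<alpha> * real (fst p) + \<beta> * real (snd p)"
  shows "p \<in> side_vertices 1 S \<union> side_vertices (- 1) S"
proof -
  define \<sigma> :: int where "\<sigma> = (if \<beta> < 0 then 1 else - 1)"
  interpret planar_points S fst "\<lambda>p. \<sigma> * int (snd p)"
    using assms(1,2) by (intro planar_points_scaled) (auto simp: \<sigma>_def)
  have "weight (- \<alpha> / \<bar>\<beta>\<bar>) p < weight (- \<alpha> / \<bar>\<beta>\<bar>) q" if "q \<in> S - {p}" for q
  proof -
    have "\<bar>\<beta>\<bar> * weight (- \<alpha> / \<bar>\<beta>\<bar>) q = - (\<alpha> * real (fst q) + \<beta> * real (snd q))" for q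
      unfolding weight_def using assms(3) by (simp add: \<sigma>_def field_simps)
    then have "\<bar>\<beta>\<bar> * weight (- \<alpha> / \<bar>\<beta>\<bar>) p < \<bar>\<beta>\<bar> * weight (- \<alpha> / \<bar>\<beta>\<bar>) q"
      using bspec[OF less that] by simp
    then show ?thesis using assms(3) by simp
  qed
  then have "p \<in> side_vertices \<sigma> S" using assms(2) unfolding side_vertices_def lower_vertices_def by blast
  then show ?thesis by (auto simp: \<sigma>_def split: if_splits)
qed

lemma extreme_points_newt_subset:
  assumes "is_bipoly F"
  shows "{v. v extreme_point_of newt F} \<subseteq>
    (\<lambda>(i, j). (real i, real j)) ` (side_vertices 1 (supp2 F) \<union> side_vertices (- 1) (supp2 F))"
proof
  let ?\<iota> = "\<lambda>(i, j). (real i, real j)"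
  define S where "S = supp2 F"
  have "finite S" using assms by (simp add: S_def is_bipoly_def)
  fix v assume "v \<in> {v. v extreme_point_of newt F}"
  then have v: "v extreme_point_of (convex hull (?\<iota> ` S))" by (simp add: newt_def S_def)
  obtain p where p: "p \<in> S" "v = ?\<iota> p"
    using extreme_point_strict_maximizer(1)[OF _ v] \<open>finite S\<close> by blast
  obtain c where c: "\<forall>x\<in>?\<iota> ` S - {v}. c \<bullet> x < c \<bullet> v"
    using extreme_point_strict_maximizer(2)[OF _ v] \<open>finite S\<close> by blast
  have "fst c * real (fst q) + snd c * real (snd q) < fst c * real (fst p) + snd c * real (snd p)"
    if "q \<in> S - {p}" for q
  proof -
    have "?\<iota> q \<in> ?\<iota> ` S - {v}" using that p by (auto simp: prod_eq_iff split_beta)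
    with c have "c \<bullet> ?\<iota> q < c \<bullet> v" by blast
    then show ?thesis by (simp add: p(2) inner_prod_def split_beta)
  qed
  then obtain \<beta> where "\<beta> \<noteq> 0" "\<forall>q\<in>S - {p}.
      fst c * real (fst q) + \<beta> * real (snd q) < fst c * real (fst p) + \<beta> * real (snd p)"
    using finite_strict_maximizer_perturb[of "S - {p}" "fst c" "\<lambda>p. real (fst p)" "snd c" "\<lambda>p. real (snd p)"]
      \<open>finite S\<close> by blast
  then have "p \<in> side_vertices 1 S \<union> side_vertices (- 1) S" using \<open>finite S\<close> p(1) by (intro mem_side_verticesI)
  then show "v \<in> ?\<iota> ` (side_vertices 1 (supp2 F) \<union> side_vertices (- 1) (supp2 F))"
    using p(2) by (simp add: S_def)
qed

lemma num_vertices_newt_le: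
  assumes "is_bipoly F" "supp2 F \<noteq> {}"
  shows "num_vertices (newt F) \<le> card (side_vertices 1 (supp2 F)) + card (side_vertices (- 1) (supp2 F))"
proof -
  let ?V = "\<lambda>\<sigma>. side_vertices \<sigma> (supp2 F)"
  have fin: "finite (?V \<sigma>)" if "\<sigma> \<noteq> 0" for \<sigma>
  proof -
    interpret planar_points "supp2 F" fst "\<lambda>p. \<sigma> * int (snd p)"
      using assms that by (intro planar_points_scaled) (auto simp: is_bipoly_def)
    show ?thesis using finite_points by (simp add: side_vertices_def lower_vertices_def)
  qed
  have "num_vertices (newt F) \<le> card ((\<lambda>(i, j). (real i, real j)) ` (?V 1 \<union> ?V (- 1)))"
    unfolding num_vertices_def using fin extreme_points_newt_subset[OF assms(1)] by (intro card_mono) auto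
  also have "\<dots> \<le> card (?V 1 \<union> ?V (- 1))" using fin by (intro card_image_le) auto
  also have "\<dots> \<le> card (?V 1) + card (?V (- 1))" by (rule card_Un_le)
  finally show ?thesis .
qed

theorem theorem2p2:
  shows "\<exists>(c::real) (k0::nat). c > 0 \<and>
    (\<forall>k\<ge>k0. \<forall>F :: nat \<times> nat \<Rightarrow> complex.
       is_bipoly F \<and> num_vertices (newt F) = k \<longrightarrow>
       (\<exists>a::complex. a \<noteq> 0 \<and> spec_y F a \<noteq> 0 \<and> bias (spec_y F a) \<ge> c * sqrt (real k)))"
proof (intro exI[of _ "1 / 12 :: real"] exI[of _ "4 :: nat"] conjI allI impI)
  fix k :: nat and F :: "nat \<times> nat \<Rightarrow> complex"
  assume "4 \<le> k" and F: "is_bipoly F \<and> num_vertices (newt F) = k"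
  then have "supp2 F \<noteq> {}" by (auto simp: num_vertices_def newt_def extreme_point_of_empty)
  then have "k \<le> card (side_vertices 1 (supp2 F)) + card (side_vertices (- 1) (supp2 F))"
    using num_vertices_newt_le F by blast
  then have "k \<le> 2 * card (side_vertices 1 (supp2 F)) \<or> k \<le> 2 * card (side_vertices (- 1) (supp2 F))" by linarith
  then obtain \<sigma> :: int where \<sigma>: "\<sigma> \<noteq> 0" "k \<le> 2 * card (side_vertices \<sigma> (supp2 F))"
    by (metis neg_equal_0_iff_equal zero_neq_one)
  obtain a where a: "a \<noteq> 0" "spec_y F a \<noteq> 0"
    "sqrt (real (card (side_vertices \<sigma> (supp2 F)) - 1)) / 6 \<le> bias (spec_y F a)"
    using exists_large_bias_spec_y[of F \<sigma>] F \<open>supp2 F \<noteq> {}\<close> \<sigma>(1) by blast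
  have "sqrt (real k / 4) \<le> sqrt (real (card (side_vertices \<sigma> (supp2 F)) - 1))"
    using \<sigma>(2) \<open>4 \<le> k\<close> by (intro real_sqrt_le_mono) linarith
  then have "1 / 12 * sqrt (real k) \<le> bias (spec_y F a)" using a(3) by (simp add: real_sqrt_divide)
  then show "\<exists>a. a \<noteq> 0 \<and> spec_y F a \<noteq> 0 \<and> 1 / 12 * sqrt (real k) \<le> bias (spec_y F a)" using a by blast
qed simp

end
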